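(* Let $\widetilde\mu=\sqrt{\mu/3}$ and $\alpha=2r/h_{\rm w}$. Under the properties (i) and (ii) stated in the context, the constrained shallow water models (described in the context) can be recast as the following transmission problem for $(\zeta,q)$ on $\mathcal E$ and $q_i=q_i(t)$: $$\partial_t\zeta+\partial_xq=0,\qquad (1-\widetilde\mu^2\partial_x^2)\partial_tq+\varepsilon\partial_x\Big(\frac{q^2}{h}\Big)+h\,\partial_x\zeta=0\qquad\text{in }\mathcal E,$$ with boundary conditions $(\zeta,q)\to(0,0)$ as $x\to-\infty$, $q=0$ at $x=\ell$, transmission conditions $$\llbracket q\rrbracket=0,\qquad\langle q\rangle=q_i,$$ and where $q_i$ satisfies the evolution equation $$\alpha\frac{dq_i}{dt}=-\llbracket\zeta+\mathfrak E\rrbracket-P_0(I-\kappa\mathcal D)\overline\zeta,\qquad \mathfrak E=\varepsilon\frac{q^2}{2h^2}-\widetilde\mu^2\frac{\partial_x\partial_tq}{h}.$$ That is: if $(\zeta,q,\underline P)$ is a regular solution of the constrained models satisfying (i) and (ii), then the restriction of $(\zeta,q)$ to $\mathcal E$ together with the interior discharge $q_i$ solves this transmission problem; conversely, every regular solution $(\zeta,q,q_i)$ of the transmission problem extends (with $\zeta=\zeta_{\rm w}$, $q=q_i$ in $\mathcal I$ and a suitable pressure $\underline P$) to a solution of the constrained models satisfying (i) and (ii).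
   Context: Parameters: $\varepsilon\in(0,1]$, $\mu\ge 0$, $0<r<\ell$, $P_0>0$, $\kappa\ge0$. Domains: $\mathcal I=(-r,r)$, $\mathcal E_-=(-\infty,-r)$, $\mathcal E_+=(r,\ell)$, $\mathcal E=\mathcal E_-\cup\mathcal E_+$, $|\mathcal E_+|=\ell-r$. $\zeta_{\rm w}$ is a constant (flat bottom of the immersed structure) and $h_{\rm w}=1+\varepsilon\zeta_{\rm w}>0$. For a function $\zeta(t,x)$, $h=1+\varepsilon\zeta>0$ and $\overline\zeta(t)=\frac1{|\mathcal E_+|}\int_{\mathcal E_+}\zeta(t,x)\,dx$. $I$ is the identity and $\mathcal D f(t)=\int_0^te^{-\kappa(t-s)}f(s)\,ds$. Constrained shallow water models: the unknowns $\zeta,q,\underline P$ (functions of $t$ and $x\in(-\infty,\ell)$) satisfy, in each of $\mathcal E_-,\mathcal I,\mathcal E_+$, $$\partial_t\zeta+\partial_xq=0,\qquad \Big(1-\frac\mu3\partial_x^2\Big)\partial_tq+\varepsilon\partial_x\Big(\frac{q^2}h\Big)+h\,\partial_x\zeta=-\frac h\varepsilon\partial_x\underline P,$$ with $(\zeta,q)\to(0,0)$ as $x\to-\infty$, $q=0$ at $x=\ell$, and the constraints $\zeta=\zeta_{\rm w}$ in $\mathcal I$, $\underline P=0$ in $\mathcal E_-$, $\underline P=\varepsilon P_0(I-\kappa\mathcal D)\overline\zeta$ in $\mathcal E_+$. Consequently in $\mathcal I$ one has $q=q_i(t)$ and $\frac{dq_i}{dt}=-\frac{h_{\rm w}}\varepsilon\partial_x\underline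 P$. "Regular" means sufficiently smooth up to the boundary on each of $\mathcal E_-,\mathcal I,\mathcal E_+$ (with possible jumps at $x=\pm r$) and sufficiently decaying at $-\infty$. Notation: for a function $G$ defined in $\mathcal I$ or in $\mathcal E$ (traces at $\pm r$ taken from that set), $\llbracket G\rrbracket=G(r)-G(-r)$ and $\langle G\rangle=\frac{G(r)+G(-r)}2$. Subscript $|_D$ denotes restriction to $D$. Properties assumed: (i) continuity of the discharge: $q_{|_{\mathcal E}}=q_i$ at $x=\pm r$; (ii) conservation of the total energy at order $O(\varepsilon\mu)$ in the non-damped case: when $\kappa=0$, $\frac{d}{dt}E_{\rm tot}=\varepsilon\mu\int_{-\infty}^\ell R\,dx$, where $E_{\rm tot}(\zeta,q)=\int_{-\infty}^\ell\big(\frac{\zeta^2}2+\frac{q^2}{2h}+\mu\frac{(\partial_xq)^2}{6h}\big)dx+\frac{P_0|\mathcal E_+|}2\overline\zeta^{\,2}$ and $R=\frac{(\partial_xq)^3}{6h^2}+\frac{q\,\partial_x\zeta\,\partial_t\partial_xq}{3h^2}$. For every $\kappa\ge0$, property (ii) is imposed through the coupling condition to which it reduces under (i), namely $$\frac{\llbracket\underline P_{|_{\mathcal I}}\rrbracket}{\varepsilon}=\Big\llbracket\zeta_{|_{\mathcal E}}+\mathfrak E_{|_{\mathcal E}}+\frac{\underline P_{|_{\mathcal E}}}\varepsilon\Big\rrbracket .$$ *)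

theory Defs
  imports "HOL-Analysis.Analysis"
begin

text \<open>
  Space-time functions are curried, time first: \<open>u t x\<close>.  Time ranges over an interval \<open>J\<close>
  starting at \<open>0\<close>.  A function with jumps at \<open>x = r\<close> and \<open>x = -r\<close> is a single function on the
  line whose values at these two points are never used: everything below depends only on its
  values on \<open>J\<close> times the open sets \<open>ext_minus r\<close>, \<open>interior_dom r\<close>, \<open>ext_plus r l\<close>.
\<close>

definition interior_dom :: "real \<Rightarrow> real set" where
  "interior_dom r = {-r<..<r}"

definition ext_minus :: "real \<Rightarrow> real set" where
  "ext_minus r = {..<-r}"

definition ext_plus :: "real \<Rightarrow> real \<Rightarrow> real set" where
  "ext_plus r l = {r<..<l}"

definition exterior_dom :: "real \<Rightarrow> real \<Rightarrow> real set" where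
  "exterior_dom r l = ext_minus r \<union> ext_plus r l"


text \<open>The time derivative is taken within \<open>J\<close>, hence is one-sided at the end points of \<open>J\<close>.\<close>

definition pd_t :: "real set \<Rightarrow> (real \<Rightarrow> real \<Rightarrow> real) \<Rightarrow> real \<Rightarrow> real \<Rightarrow> real" where
  "pd_t J u t x = vector_derivative (\<lambda>s. u s x) (at t within J)"

definition pd_x :: "(real \<Rightarrow> real \<Rightarrow> real) \<Rightarrow> real \<Rightarrow> real \<Rightarrow> real" where
  "pd_x u t x = deriv (u t) x"

text \<open>All iterated partial derivatives of order at most \<open>n\<close>, in every order of differentiation.\<close>

primrec derivs_upto ::
  "nat \<Rightarrow> real set \<Rightarrow> (real \<Rightarrow> real \<Rightarrow> real) \<Rightarrow> (real \<Rightarrow> real \<Rightarrow> real) set" where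
  "derivs_upto 0 J u = {u}"
| "derivs_upto (Suc n) J u =
     insert u (derivs_upto n J (pd_t J u) \<union> derivs_upto n J (pd_x u))"

definition differentiable_tx ::
  "real set \<Rightarrow> real set \<Rightarrow> (real \<Rightarrow> real \<Rightarrow> real) \<Rightarrow> bool" where
  "differentiable_tx J D u \<longleftrightarrow>
     (\<forall>t\<in>J. \<forall>x\<in>D. (\<lambda>s. u s x) differentiable (at t within J) \<and> u t differentiable (at x))"

definition cont_up_to_boundary ::
  "real set \<Rightarrow> real set \<Rightarrow> (real \<Rightarrow> real \<Rightarrow> real) \<Rightarrow> bool" where
  "cont_up_to_boundary J D u \<longleftrightarrow>
     (\<exists>v. continuous_on (J \<times> closure D) (\<lambda>(t, x). v t x) \<and> (\<forall>t\<in>J. \<forall>x\<in>D. v t x = u t x))"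

text \<open>Class \<open>C\<^sup>n\<close> on \<open>J \<times> D\<close>, up to the boundary of the open set \<open>D\<close>.\<close>

definition Cn_up_to_boundary ::
  "nat \<Rightarrow> real set \<Rightarrow> real set \<Rightarrow> (real \<Rightarrow> real \<Rightarrow> real) \<Rightarrow> bool" where
  "Cn_up_to_boundary n J D u \<longleftrightarrow>
     (\<forall>k<n. \<forall>v\<in>derivs_upto k J u. differentiable_tx J D v) \<and>
     (\<forall>v\<in>derivs_upto n J u. cont_up_to_boundary J D v)"

text \<open>
  Decay at \<open>-\<infinity>\<close>: locally uniformly in time, the derivatives of order at most \<open>n\<close> are dominated
  by a square integrable function of \<open>x\<close>.
\<close>

definition decaying :: "nat \<Rightarrow> real set \<Rightarrow> real \<Rightarrow> (real \<Rightarrow> real \<Rightarrow> real) \<Rightarrow> bool" where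
  "decaying n J r u \<longleftrightarrow>
     (\<forall>v\<in>derivs_upto n J u. \<forall>K. compact K \<and> K \<subseteq> J \<longrightarrow>
        (\<exists>g. set_integrable lborel (ext_minus r) (\<lambda>x. (g x)\<^sup>2) \<and>
             (\<forall>t\<in>K. \<forall>x\<in>ext_minus r. \<bar>v t x\<bar> \<le> g x)))"


text \<open>Trace at \<open>a\<close> taken from \<open>D\<close>.\<close>

definition trace :: "real set \<Rightarrow> real \<Rightarrow> (real \<Rightarrow> real) \<Rightarrow> real" where
  "trace D a G = Lim (at a within D) G"

definition jump :: "real \<Rightarrow> real set \<Rightarrow> (real \<Rightarrow> real) \<Rightarrow> real" where
  "jump r D G = trace D r G - trace D (-r) G"

definition average :: "real \<Rightarrow> real set \<Rightarrow> (real \<Rightarrow> real) \<Rightarrow> real" where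
  "average r D G = (trace D r G + trace D (-r) G) / 2"

definition mean_plus :: "real \<Rightarrow> real \<Rightarrow> (real \<Rightarrow> real \<Rightarrow> real) \<Rightarrow> real \<Rightarrow> real" where
  "mean_plus r l \<zeta> t = 1 / (l - r) * integral (ext_plus r l) (\<zeta> t)"

definition damping_op :: "real \<Rightarrow> (real \<Rightarrow> real) \<Rightarrow> real \<Rightarrow> real" where
  "damping_op \<kappa> f t = integral {0..t} (\<lambda>s. exp (- \<kappa> * (t - s)) * f s)"

definition depth :: "real \<Rightarrow> (real \<Rightarrow> real \<Rightarrow> real) \<Rightarrow> real \<Rightarrow> real \<Rightarrow> real" where
  "depth \<epsilon> \<zeta> t x = 1 + \<epsilon> * \<zeta> t x"

text \<open>
  Positivity of the depth up to the boundary of \<open>D\<close>, so that quotients by the depth have traces.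
\<close>

definition positive_depth ::
  "real \<Rightarrow> real set \<Rightarrow> real set \<Rightarrow> (real \<Rightarrow> real \<Rightarrow> real) \<Rightarrow> bool" where
  "positive_depth \<epsilon> J D \<zeta> \<longleftrightarrow> (\<forall>t\<in>J. \<exists>c>0. \<forall>x\<in>D. c \<le> depth \<epsilon> \<zeta> t x)"

text \<open>The quantity \<open>\<EE>\<close>; \<open>\<mu>'\<close> stands for \<open>sqrt (\<mu> / 3)\<close>.\<close>

definition frakE ::
  "real \<Rightarrow> real \<Rightarrow> real set \<Rightarrow> (real \<Rightarrow> real \<Rightarrow> real) \<Rightarrow> (real \<Rightarrow> real \<Rightarrow> real) \<Rightarrow> real \<Rightarrow> real \<Rightarrow> real" where
  "frakE \<epsilon> \<mu>' J \<zeta> q t x =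
     \<epsilon> * (q t x)\<^sup>2 / (2 * (depth \<epsilon> \<zeta> t x)\<^sup>2)
     - \<mu>'\<^sup>2 * (pd_x (pd_t J q) t x / depth \<epsilon> \<zeta> t x)"

definition decay_bc :: "real set \<Rightarrow> (real \<Rightarrow> real \<Rightarrow> real) \<Rightarrow> (real \<Rightarrow> real \<Rightarrow> real) \<Rightarrow> bool" where
  "decay_bc J \<zeta> q \<longleftrightarrow> (\<forall>t\<in>J. (\<zeta> t \<longlongrightarrow> 0) at_bot \<and> (q t \<longlongrightarrow> 0) at_bot)"

definition wall_bc :: "real set \<Rightarrow> real \<Rightarrow> real \<Rightarrow> (real \<Rightarrow> real \<Rightarrow> real) \<Rightarrow> bool" where
  "wall_bc J r l q \<longleftrightarrow> (\<forall>t\<in>J. trace (ext_plus r l) l (q t) = 0)"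


definition constrained_model ::
  "real \<Rightarrow> real \<Rightarrow> real \<Rightarrow> real \<Rightarrow> real \<Rightarrow> real \<Rightarrow> real \<Rightarrow> real set \<Rightarrow>
   (real \<Rightarrow> real \<Rightarrow> real) \<Rightarrow> (real \<Rightarrow> real \<Rightarrow> real) \<Rightarrow> (real \<Rightarrow> real \<Rightarrow> real) \<Rightarrow> bool" where
  "constrained_model \<epsilon> \<mu> r l P0 \<kappa> \<zeta>w J \<zeta> q P \<longleftrightarrow>
     (\<forall>D\<in>{ext_minus r, interior_dom r, ext_plus r l}.
        positive_depth \<epsilon> J D \<zeta> \<and>
        (\<forall>t\<in>J. \<forall>x\<in>D.
           pd_t J \<zeta> t x + pd_x q t x = 0 \<and>
           pd_t J q t x - \<mu> / 3 * pd_x (pd_x (pd_t J q)) t x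
             + \<epsilon> * pd_x (\<lambda>t x. (q t x)\<^sup>2 / depth \<epsilon> \<zeta> t x) t x
             + depth \<epsilon> \<zeta> t x * pd_x \<zeta> t x
           = - depth \<epsilon> \<zeta> t x / \<epsilon> * pd_x P t x)) \<and>
     decay_bc J \<zeta> q \<and> wall_bc J r l q \<and>
     (\<forall>t\<in>J. \<forall>x\<in>interior_dom r. \<zeta> t x = \<zeta>w) \<and>
     (\<forall>t\<in>J. \<forall>x\<in>ext_minus r. P t x = 0) \<and>
     (\<forall>t\<in>J. \<forall>x\<in>ext_plus r l.
        P t x = \<epsilon> * P0 * (mean_plus r l \<zeta> t - \<kappa> * damping_op \<kappa> (mean_plus r l \<zeta>) t))"

text \<open>
  By the momentum equation the pressure is one derivative less regular than \<open>\<zeta>\<close> and \<open>q\<close>.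
\<close>

definition regular_constrained ::
  "nat \<Rightarrow> real \<Rightarrow> real \<Rightarrow> real set \<Rightarrow>
   (real \<Rightarrow> real \<Rightarrow> real) \<Rightarrow> (real \<Rightarrow> real \<Rightarrow> real) \<Rightarrow> (real \<Rightarrow> real \<Rightarrow> real) \<Rightarrow> bool" where
  "regular_constrained n r l J \<zeta> q P \<longleftrightarrow>
     (\<forall>D\<in>{ext_minus r, interior_dom r, ext_plus r l}.
        Cn_up_to_boundary n J D \<zeta> \<and> Cn_up_to_boundary n J D q \<and>
        Cn_up_to_boundary (n - 1) J D P) \<and>
     decaying n J r \<zeta> \<and> decaying n J r q"

definition interior_discharge ::
  "real \<Rightarrow> real set \<Rightarrow> (real \<Rightarrow> real \<Rightarrow> real) \<Rightarrow> (real \<Rightarrow> real) \<Rightarrow> bool" where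
  "interior_discharge r J q qi \<longleftrightarrow> (\<forall>t\<in>J. \<forall>x\<in>interior_dom r. q t x = qi t)"

definition discharge_continuity ::
  "real \<Rightarrow> real \<Rightarrow> real set \<Rightarrow> (real \<Rightarrow> real \<Rightarrow> real) \<Rightarrow> (real \<Rightarrow> real) \<Rightarrow> bool" where
  "discharge_continuity r l J q qi \<longleftrightarrow>
     (\<forall>t\<in>J. \<forall>a\<in>{-r, r}. trace (exterior_dom r l) a (q t) = qi t)"

text \<open>
  Conservation of the total energy at order \<open>O(\<epsilon> \<mu>)\<close>, imposed (for all \<open>\<kappa> \<ge> 0\<close>) through the
  coupling condition on the traces of the pressure.
\<close>

definition energy_coupling ::
  "real \<Rightarrow> real \<Rightarrow> real \<Rightarrow> real \<Rightarrow> real set \<Rightarrow>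
   (real \<Rightarrow> real \<Rightarrow> real) \<Rightarrow> (real \<Rightarrow> real \<Rightarrow> real) \<Rightarrow> (real \<Rightarrow> real \<Rightarrow> real) \<Rightarrow> bool" where
  "energy_coupling \<epsilon> \<mu>' r l J \<zeta> q P \<longleftrightarrow>
     (\<forall>t\<in>J. jump r (interior_dom r) (P t) / \<epsilon> =
        jump r (exterior_dom r l) (\<lambda>x. \<zeta> t x + frakE \<epsilon> \<mu>' J \<zeta> q t x + P t x / \<epsilon>))"


definition transmission_problem ::
  "real \<Rightarrow> real \<Rightarrow> real \<Rightarrow> real \<Rightarrow> real \<Rightarrow> real \<Rightarrow> real \<Rightarrow> real set \<Rightarrow>
   (real \<Rightarrow> real \<Rightarrow> real) \<Rightarrow> (real \<Rightarrow> real \<Rightarrow> real) \<Rightarrow> (real \<Rightarrow> real) \<Rightarrow> bool" where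
  "transmission_problem \<epsilon> \<mu>' r l P0 \<kappa> \<alpha> J \<zeta> q qi \<longleftrightarrow>
     positive_depth \<epsilon> J (exterior_dom r l) \<zeta> \<and>
     (\<forall>t\<in>J. \<forall>x\<in>exterior_dom r l.
        pd_t J \<zeta> t x + pd_x q t x = 0 \<and>
        pd_t J q t x - \<mu>'\<^sup>2 * pd_x (pd_x (pd_t J q)) t x
          + \<epsilon> * pd_x (\<lambda>t x. (q t x)\<^sup>2 / depth \<epsilon> \<zeta> t x) t x
          + depth \<epsilon> \<zeta> t x * pd_x \<zeta> t x = 0) \<and>
     decay_bc J \<zeta> q \<and> wall_bc J r l q \<and>
     (\<forall>t\<in>J. jump r (exterior_dom r l) (q t) = 0 \<and> average r (exterior_dom r l) (q t) = qi t) \<and>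
     (\<forall>t\<in>J. \<alpha> * vector_derivative qi (at t within J) =
        - jump r (exterior_dom r l) (\<lambda>x. \<zeta> t x + frakE \<epsilon> \<mu>' J \<zeta> q t x)
        - P0 * (mean_plus r l \<zeta> t - \<kappa> * damping_op \<kappa> (mean_plus r l \<zeta>) t))"

text \<open>
  The last conjunct says that \<open>qi\<close> is of class \<open>C\<^sup>n\<close> on \<open>J\<close>, viewing it as a function of \<open>(t, x)\<close>
  that is constant in \<open>x\<close>.
\<close>

definition regular_transmission ::
  "nat \<Rightarrow> real \<Rightarrow> real \<Rightarrow> real set \<Rightarrow>
   (real \<Rightarrow> real \<Rightarrow> real) \<Rightarrow> (real \<Rightarrow> real \<Rightarrow> real) \<Rightarrow> (real \<Rightarrow> real) \<Rightarrow> bool" where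
  "regular_transmission n r l J \<zeta> q qi \<longleftrightarrow>
     (\<forall>D\<in>{ext_minus r, ext_plus r l}.
        Cn_up_to_boundary n J D \<zeta> \<and> Cn_up_to_boundary n J D q) \<and>
     decaying n J r \<zeta> \<and> decaying n J r q \<and>
     Cn_up_to_boundary n J (interior_dom r) (\<lambda>t x. qi t)"

end

theory Submission
  imports Defs
begin

text \<open>
  In the interior the mass equation forces \<open>q = q\<^sub>i(t)\<close>, and the momentum equation then says that
  the pressure is affine in \<open>x\<close> with slope \<open>- (\<epsilon> / h\<^sub>w) q\<^sub>i'\<close>; its jump across the structure is
  therefore \<open>- \<epsilon> \<alpha> q\<^sub>i'\<close>.  In the exterior the pressure is locally constant in \<open>x\<close>, so it drops out
  of the momentum equation and contributes only \<open>P\<^sub>0 (I - \<kappa> D)\<close> of the mean elevation to the jump on the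
  right-hand side of the coupling condition, which then becomes the evolution equation of \<open>q\<^sub>i\<close>.
  For the converse these formulas define the pressure.  Its regularity in time rests on
  differentiation under the integral sign for the mean and on \<open>(D f)' = f - \<kappa> D f\<close> for the damping
  operator.
\<close>

section \<open>The class of functions smooth up to the boundary\<close>

lemma pd_t_cong:
  assumes "\<And>s. s \<in> J \<Longrightarrow> u s x = v s x" "t \<in> J"
  shows "pd_t J u t x = pd_t J v t x"
  unfolding pd_t_def by (rule vector_derivative_cong_eq) (auto simp: assms)

lemma pd_x_cong:
  assumes "open D" "x \<in> D" "\<And>y. y \<in> D \<Longrightarrow> u t y = v t y"
  shows "pd_x u t x = pd_x v t x"
  unfolding pd_x_def
  by (rule deriv_cong_ev) (use assms eventually_nhds_in_open[of D x] in \<open>auto elim: eventually_mono\<close>)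

text \<open>At an isolated point of \<open>J\<close> every number is a derivative within
  \<open>J\<close>. The condition \<open>at t within J \<noteq> bot\<close> makes it unique, so that
  \<open>pd_t\<close> can be computed by the usual rules.\<close>

lemma pd_t_eqI:
  assumes "((\<lambda>s. u s x) has_vector_derivative d) (at t within J)" "at t within J \<noteq> bot"
  shows "pd_t J u t x = d"
  unfolding pd_t_def by (rule vector_derivative_within[OF assms(2,1)])

lemma pd_x_eqI: "(u t has_field_derivative d) (at x) \<Longrightarrow> pd_x u t x = d"
  unfolding pd_x_def by (rule DERIV_imp_deriv)

lemma differentiable_tx_cong:
  assumes "open D" "\<And>t x. t \<in> J \<Longrightarrow> x \<in> D \<Longrightarrow> u t x = v t x" "differentiable_tx J D u"
  shows "differentiable_tx J D v"
  unfolding differentiable_tx_def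
proof (intro ballI conjI)
  fix t x assume tx: "t \<in> J" "x \<in> D"
  show "(\<lambda>s. v s x) differentiable (at t within J)"
    by (rule differentiable_transform_within[of "\<lambda>s. u s x" t J 1])
       (use assms tx in \<open>auto simp: differentiable_tx_def\<close>)
  obtain e where e: "0 < e" "\<And>y. dist y x < e \<Longrightarrow> y \<in> D"
    using assms(1) tx by (auto simp: open_dist)
  show "v t differentiable (at x)"
    by (rule differentiable_transform_within[of "u t" x UNIV e])
       (use assms tx e in \<open>auto simp: differentiable_tx_def\<close>)
qed

lemma cont_up_to_boundary_cong:
  assumes "\<And>t x. t \<in> J \<Longrightarrow> x \<in> D \<Longrightarrow> u t x = v t x" "cont_up_to_boundary J D u"
  shows "cont_up_to_boundary J D v"
proof -
  obtain w where "continuous_on (J \<times> closure D) (\<lambda>(t, x). w t x)" "\<forall>t\<in>J. \<forall>x\<in>D. w t x = u t x"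
    using assms(2) unfolding cont_up_to_boundary_def by blast
  then show ?thesis
    unfolding cont_up_to_boundary_def using assms(1) by (intro exI[of _ w]) auto
qed

lemma Cn_0: "Cn_up_to_boundary 0 J D u \<longleftrightarrow> cont_up_to_boundary J D u"
  by (simp add: Cn_up_to_boundary_def)

text \<open>A derivative of order at most n + 1 is \<open>u\<close> itself or a derivative of order
  at most n of \<open>pd_t J u\<close> or \<open>pd_x u\<close>. This recursion drives the
  inductions on the class below.\<close>

lemma Cn_Suc:
  "Cn_up_to_boundary (Suc n) J D u \<longleftrightarrow>
     differentiable_tx J D u \<and> cont_up_to_boundary J D u \<and>
     Cn_up_to_boundary n J D (pd_t J u) \<and> Cn_up_to_boundary n J D (pd_x u)"
proof -
  have self: "w \<in> derivs_upto k J w" for k w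
    by (cases k) auto
  have all_less_Suc: "(\<forall>k<Suc n. Q k) \<longleftrightarrow> Q 0 \<and> (\<forall>k<n. Q (Suc k))" for Q
    by (auto simp: less_Suc_eq_0_disj)
  have 1: "(\<forall>k<Suc n. \<forall>v\<in>derivs_upto k J u. differentiable_tx J D v) \<longleftrightarrow>
      differentiable_tx J D u \<and>
      (\<forall>k<n. \<forall>v\<in>derivs_upto k J (pd_t J u). differentiable_tx J D v) \<and>
      (\<forall>k<n. \<forall>v\<in>derivs_upto k J (pd_x u). differentiable_tx J D v)"
    unfolding all_less_Suc by (simp add: ball_Un) blast
  show ?thesis
    unfolding Cn_up_to_boundary_def 1 by (simp add: ball_Un) blast
qed

lemma Cn_imp_cont: "Cn_up_to_boundary n J D u \<Longrightarrow> cont_up_to_boundary J D u"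
  by (cases n) (auto simp: Cn_0 Cn_Suc)

lemma Cn_Suc_imp: "Cn_up_to_boundary (Suc n) J D u \<Longrightarrow> Cn_up_to_boundary n J D u"
proof (induction n arbitrary: u)
  case 0
  then show ?case by (simp add: Cn_0 Cn_Suc)
next
  case (Suc n)
  from Suc.prems have "Cn_up_to_boundary n J D (pd_t J u)" "Cn_up_to_boundary n J D (pd_x u)"
    using Suc.IH[of "pd_t J u"] Suc.IH[of "pd_x u"] Cn_Suc[of "Suc n" J D u] by blast+
  with Suc.prems show ?case
    unfolding Cn_Suc[of n J D u] Cn_Suc[of "Suc n" J D u] by blast
qed

text \<open>The time derivative is taken within \<open>J\<close> and the space derivative at points
  of the open set \<open>D\<close>, so agreement on \<open>J\<close> times \<open>D\<close> passes
  to both derivatives and the induction continues with them. Functions glued from pieces are handled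
  this way.\<close>

lemma Cn_cong:
  assumes "open D" "\<And>t x. t \<in> J \<Longrightarrow> x \<in> D \<Longrightarrow> u t x = v t x" "Cn_up_to_boundary n J D u"
  shows "Cn_up_to_boundary n J D v"
  using assms(2,3)
proof (induction n arbitrary: u v)
  case 0
  then show ?case using cont_up_to_boundary_cong[of J D u v] by (simp add: Cn_0)
next
  case (Suc n)
  have "Cn_up_to_boundary n J D (pd_t J v)"
    by (rule Suc.IH[of "pd_t J u"]) (use Suc.prems in \<open>auto simp: Cn_Suc intro!: pd_t_cong\<close>)
  moreover have "Cn_up_to_boundary n J D (pd_x v)"
    by (rule Suc.IH[of "pd_x u"])
       (use Suc.prems in \<open>auto simp: Cn_Suc intro!: pd_x_cong[OF \<open>open D\<close>]\<close>)
  ultimately show ?case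
    using Suc.prems differentiable_tx_cong[OF \<open>open D\<close>, of J u v] cont_up_to_boundary_cong[of J D u v]
    by (auto simp: Cn_Suc)
qed

text \<open>Each iterated derivative of \<open>v\<close> has a counterpart for \<open>u\<close>,
  taken in the same order of differentiation, with the same values on \<open>J\<close> times
  \<open>ext_minus r\<close>. The dominating function of the counterpart therefore serves
  again.\<close>

lemma decaying_cong:
  assumes "\<And>t x. t \<in> J \<Longrightarrow> x < -r \<Longrightarrow> u t x = v t x" "decaying n J r u"
  shows "decaying n J r v"
proof -
  have "\<exists>w'\<in>derivs_upto n J u. \<forall>t\<in>J. \<forall>x\<in>ext_minus r. w' t x = w t x"
    if "w \<in> derivs_upto n J v" "\<And>t x. t \<in> J \<Longrightarrow> x \<in> ext_minus r \<Longrightarrow> u t x = v t x" for w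
    using that
  proof (induction n arbitrary: u v)
    case 0
    then show ?case by auto
  next
    case (Suc n)
    have o: "open (ext_minus r)" by (simp add: ext_minus_def)
    from Suc.prems(1) consider "w = v" | "w \<in> derivs_upto n J (pd_t J v)" | "w \<in> derivs_upto n J (pd_x v)"
      by auto
    then show ?case
    proof cases
      case 1
      then show ?thesis using Suc.prems by auto
    next
      case 2
      have "\<exists>w'\<in>derivs_upto n J (pd_t J u). \<forall>t\<in>J. \<forall>x\<in>ext_minus r. w' t x = w t x"
        by (rule Suc.IH[OF 2], rule pd_t_cong) (use Suc.prems in auto)
      then show ?thesis by auto
    next
      case 3
      have "\<exists>w'\<in>derivs_upto n J (pd_x u). \<forall>t\<in>J. \<forall>x\<in>ext_minus r. w' t x = w t x"
        by (rule Suc.IH[OF 3], rule pd_x_cong[OF o]) (use Suc.prems in auto)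
      then show ?thesis by auto
    qed
  qed
  note * = this
  show ?thesis
    unfolding decaying_def
  proof (intro ballI allI impI)
    fix w K
    assume w: "w \<in> derivs_upto n J v" and K: "compact K \<and> K \<subseteq> J"
    obtain w' where w': "w' \<in> derivs_upto n J u" "\<forall>t\<in>J. \<forall>x\<in>ext_minus r. w' t x = w t x"
      using *[OF w] assms(1) by (auto simp: ext_minus_def)
    then show "\<exists>g. set_integrable lborel (ext_minus r) (\<lambda>x. (g x)\<^sup>2) \<and>
             (\<forall>t\<in>K. \<forall>x\<in>ext_minus r. \<bar>w t x\<bar> \<le> g x)"
      using assms(2) K unfolding decaying_def by (metis subsetD)
  qed
qed

section \<open>Linear combinations, functions of time alone, and their products with x\<close>

lemma Cn_lincomb:
  assumes "open D" "\<And>t. t \<in> J \<Longrightarrow> at t within J \<noteq> bot"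
    and "Cn_up_to_boundary n J D u" "Cn_up_to_boundary n J D v"
  shows "Cn_up_to_boundary n J D (\<lambda>t x. a * u t x + b * v t x)"
  using assms(3,4)
proof (induction n arbitrary: u v)
  case (0 u v)
  then obtain u' v' where
    "continuous_on (J \<times> closure D) (\<lambda>(t, x). u' t x)" "\<forall>t\<in>J. \<forall>x\<in>D. u' t x = u t x"
    "continuous_on (J \<times> closure D) (\<lambda>(t, x). v' t x)" "\<forall>t\<in>J. \<forall>x\<in>D. v' t x = v t x"
    by (auto simp: Cn_0 cont_up_to_boundary_def)
  moreover from this have
    "continuous_on (J \<times> closure D) (\<lambda>(t, x). a * u' t x + b * v' t x)"
    unfolding case_prod_unfold by (intro continuous_intros)
  ultimately show ?case
    unfolding Cn_0 cont_up_to_boundary_def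
    by (intro exI[of _ "\<lambda>t x. a * u' t x + b * v' t x"]) auto
next
  case (Suc n u v)
  let ?w = "\<lambda>t x. a * u t x + b * v t x"
  \<comment> \<open>The induction hypothesis is used in two ways: here for \<open>u\<close> and
    \<open>v\<close> themselves, seen as functions of class n, and further down for their
    derivatives.\<close>
  have "cont_up_to_boundary J D ?w"
    using Cn_imp_cont[OF Suc.IH[of u v]] Suc.prems Cn_Suc_imp by blast
  moreover have "differentiable_tx J D ?w"
    using Suc.prems
    by (auto simp: Cn_Suc differentiable_tx_def intro!: differentiable_add differentiable_mult)
  moreover have pt: "pd_t J ?w t x = a * pd_t J u t x + b * pd_t J v t x" if "t \<in> J" "x \<in> D" for t x
    using that Suc.prems assms(2)
    by (intro pd_t_eqI)
       (auto simp: Cn_Suc differentiable_tx_def pd_t_def vector_derivative_works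
         intro!: has_vector_derivative_add has_vector_derivative_mult_right)
  moreover have "Cn_up_to_boundary n J D (pd_t J ?w)"
    by (rule Cn_cong[OF \<open>open D\<close> _ Suc.IH[of "pd_t J u" "pd_t J v"], rotated])
       (use Suc.prems pt in \<open>auto simp: Cn_Suc\<close>)
  moreover have px: "pd_x ?w t x = a * pd_x u t x + b * pd_x v t x" if "t \<in> J" "x \<in> D" for t x
    using that Suc.prems
    by (intro pd_x_eqI)
       (auto simp: Cn_Suc differentiable_tx_def pd_x_def DERIV_deriv_iff_real_differentiable
         intro!: DERIV_add DERIV_cmult)
  moreover have "Cn_up_to_boundary n J D (pd_x ?w)"
    by (rule Cn_cong[OF \<open>open D\<close> _ Suc.IH[of "pd_x u" "pd_x v"], rotated])
       (use Suc.prems px in \<open>auto simp: Cn_Suc\<close>)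
  ultimately show ?case
    by (simp add: Cn_Suc)
qed

text \<open>Zero comes before the other constants because \<open>Cn_Suc_time\<close>, from which
  \<open>Cn_const\<close> is derived, needs it for the space derivative.\<close>

lemma Cn_zero:
  assumes "\<And>t. t \<in> J \<Longrightarrow> at t within J \<noteq> bot" "open D"
  shows "Cn_up_to_boundary n J D (\<lambda>t x. 0)"
proof (induction n)
  case 0
  show ?case by (auto simp: Cn_0 cont_up_to_boundary_def intro!: exI[of _ "\<lambda>t x. 0"])
next
  case (Suc n)
  have "pd_t J (\<lambda>t x. 0) t x = 0" if "t \<in> J" for t x
    using assms that by (intro pd_t_eqI) auto
  moreover have px: "pd_x (\<lambda>t x. 0) t x = 0" for t x
    by (intro pd_x_eqI) auto
  ultimately show ?case
    using Suc Cn_cong[OF \<open>open D\<close> _ Suc, of "pd_t J (\<lambda>t x. 0)"]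
      Cn_cong[OF \<open>open D\<close> _ Suc, of "pd_x (\<lambda>t x. 0)"] Cn_imp_cont[OF Suc]
    by (auto simp: Cn_Suc differentiable_tx_def)
qed

lemma Cn_0_time:
  assumes "continuous_on J f"
  shows "Cn_up_to_boundary 0 J D (\<lambda>t x. f t)"
proof -
  have "continuous_on (J \<times> closure D) (\<lambda>p. f (fst p))"
    by (rule continuous_on_compose2[OF assms]) (auto intro: continuous_on_fst continuous_on_id)
  then show ?thesis
    by (auto simp: Cn_0 cont_up_to_boundary_def case_prod_unfold intro!: exI[of _ "\<lambda>t x. f t"])
qed

text \<open>The space derivative is zero, so only the time derivative has to be controlled. For the
  mean and the damping operator this gains one order at a time.\<close>

lemma Cn_Suc_time:
  assumes J: "\<And>t. t \<in> J \<Longrightarrow> at t within J \<noteq> bot" and D: "open D"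
    and f: "\<And>t. t \<in> J \<Longrightarrow> (f has_vector_derivative f' t) (at t within J)"
    and f': "Cn_up_to_boundary n J D (\<lambda>t x. f' t)"
  shows "Cn_up_to_boundary (Suc n) J D (\<lambda>t x. f t)"
proof -
  have "continuous_on J f"
    using f by (meson continuous_on_eq_continuous_within has_vector_derivative_continuous)
  then have "cont_up_to_boundary J D (\<lambda>t x. f t)"
    by (rule Cn_imp_cont[OF Cn_0_time])
  moreover have "differentiable_tx J D (\<lambda>t x. f t)"
    using f by (auto simp: differentiable_tx_def differentiable_def has_vector_derivative_def)
  moreover have pt: "pd_t J (\<lambda>t x. f t) t x = f' t" if "t \<in> J" for t x
    using J f that by (intro pd_t_eqI) auto
  moreover have "Cn_up_to_boundary n J D (pd_t J (\<lambda>t x. f t))"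
    by (rule Cn_cong[OF D _ f']) (simp add: pt)
  moreover have px: "pd_x (\<lambda>t x. f t) t x = 0" for t x
    by (intro pd_x_eqI) auto
  moreover have "Cn_up_to_boundary n J D (pd_x (\<lambda>t x. f t))"
    by (rule Cn_cong[OF D _ Cn_zero[OF J D]]) (simp_all add: px)
  ultimately show ?thesis
    by (simp add: Cn_Suc)
qed

lemma Cn_const:
  assumes "\<And>t. t \<in> J \<Longrightarrow> at t within J \<noteq> bot" "open D"
  shows "Cn_up_to_boundary n J D (\<lambda>t x. c)"
  by (rule Cn_Suc_imp, rule Cn_Suc_time[where f' = "\<lambda>t. 0"]) (auto simp: assms intro!: Cn_zero)

text \<open>The point \<open>x0\<close> makes \<open>D\<close> nonempty. Over an empty
  \<open>D\<close> the differentiability condition would say nothing about \<open>f\<close>.\<close>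

lemma Cn_time_deriv:
  assumes "open D" "x0 \<in> D" "Cn_up_to_boundary (Suc n) J D (\<lambda>t x. f t)"
  shows "Cn_up_to_boundary n J D (\<lambda>t x. vector_derivative f (at t within J))"
    and "\<And>t. t \<in> J \<Longrightarrow> (f has_vector_derivative vector_derivative f (at t within J)) (at t within J)"
  using assms unfolding Cn_Suc
  by (auto simp: pd_t_def[abs_def] differentiable_tx_def simp flip: vector_derivative_works)

lemma Cn_time_cont:
  assumes "x0 \<in> D" "Cn_up_to_boundary n J D (\<lambda>t x. f t)"
  shows "continuous_on J f"
proof -
  obtain v where v: "continuous_on (J \<times> closure D) (\<lambda>(t, x). v t x)" "\<forall>t\<in>J. \<forall>x\<in>D. v t x = f t"
    using Cn_imp_cont[OF assms(2)] by (auto simp: cont_up_to_boundary_def)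
  have "continuous_on J (\<lambda>t. (\<lambda>(t, x). v t x) (t, x0))"
    using assms(1) closure_subset[of D]
    by (intro continuous_on_compose2[OF v(1)] continuous_intros) auto
  then show ?thesis
    by (rule continuous_on_eq) (use v assms in auto)
qed

text \<open>The class is stable under both derivatives: in time \<open>a\<close> is replaced by its
  derivative, in space \<open>a\<close> itself remains. The interior pressure has this form.\<close>

lemma Cn_time_mult_x:
  assumes J: "\<And>t. t \<in> J \<Longrightarrow> at t within J \<noteq> bot" and D: "open D" "x0 \<in> D"
    and "Cn_up_to_boundary n J D (\<lambda>t x. a t)"
  shows "Cn_up_to_boundary n J D (\<lambda>t x. a t * x)"
  using assms(4)
proof (induction n arbitrary: a)
  case (0 a)
  have "continuous_on (J \<times> closure D) (\<lambda>p. a (fst p) * snd p)"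
    by (intro continuous_intros continuous_on_compose2[OF Cn_time_cont[OF D(2) 0]]) auto
  then show ?case
    by (auto simp: Cn_0 cont_up_to_boundary_def case_prod_unfold intro!: exI[of _ "\<lambda>t x. a t * x"])
next
  case (Suc n a)
  let ?w = "\<lambda>t x. a t * x"
  note d = Cn_time_deriv[OF D Suc.prems]
  have "cont_up_to_boundary J D ?w"
    using Cn_imp_cont[OF Suc.IH[of a]] Suc.prems Cn_Suc_imp by blast
  moreover have dw: "((\<lambda>s. ?w s x) has_vector_derivative vector_derivative a (at t within J) * x) (at t within J)"
    if "t \<in> J" for t x
    by (rule has_vector_derivative_mult_left[OF d(2)[OF that]])
  moreover have "differentiable_tx J D ?w"
    using differentiableI_vector[OF dw] by (auto simp: differentiable_tx_def)
  moreover have pt: "pd_t J ?w t x = vector_derivative a (at t within J) * x" if "t \<in> J" for t x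
    by (rule pd_t_eqI[OF dw[OF that] J[OF that]])
  moreover have "Cn_up_to_boundary n J D (pd_t J ?w)"
    by (rule Cn_cong[OF D(1) _ Suc.IH[OF d(1)]]) (simp add: pt)
  moreover have px: "pd_x ?w t x = a t" for t x
    by (intro pd_x_eqI) (auto intro!: derivative_eq_intros)
  moreover have "Cn_up_to_boundary n J D (pd_x ?w)"
    by (rule Cn_cong[OF D(1) _ Cn_Suc_imp[OF Suc.prems]]) (simp add: px)
  ultimately show ?case
    by (simp add: Cn_Suc)
qed

section \<open>The mean elevation and the damping operator\<close>

text \<open>An interval that contains 0 and is not \<open>{0}\<close> has two points, and a
  connected set with two points has no isolated point.\<close>

lemma at_within_time_nontrivial:
  assumes "is_interval J" "0 \<in> J" "J \<noteq> {0::real}" "t \<in> J"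
  shows "at t within J \<noteq> bot"
proof -
  have "\<nexists>x. J = {x}"
    using assms by auto
  then have "t islimpt J"
    using assms by (intro connected_imp_perfect is_interval_connected) auto
  then show ?thesis
    by (simp add: trivial_limit_within)
qed

lemma integral_from_0_has_vector_derivative:
  fixes f :: "real \<Rightarrow> real"
  assumes J: "is_interval J" "0 \<in> J" "J \<subseteq> {0..}" and f: "continuous_on J f" and t: "t \<in> J"
  shows "((\<lambda>t. integral {0..t} f) has_vector_derivative f t) (at t within J)"
proof -
  have sub: "{0..b} \<subseteq> J" if "b \<in> J" for b
    using mem_is_interval_1_I[OF J(1,2) that] by auto
  \<comment> \<open>The fundamental theorem of calculus is applied on a compact interval, whereas
    \<open>J\<close> may be unbounded or open on the right. If some \<open>b\<close> in
    \<open>J\<close> exceeds \<open>t\<close>, then \<open>J\<close> and \<open>{0..b}\<close>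
    coincide below \<open>b\<close>; otherwise \<open>t\<close> is the last point and
    \<open>J = {0..t}\<close>.\<close>
  obtain b where b: "b \<in> J" "t \<le> b" "at t within J = at t within {0..b}"
  proof (cases "\<exists>b\<in>J. t < b")
    case True
    then obtain b where b: "b \<in> J" "t < b"
      by blast
    have "J \<inter> {..<b} - {t} = {0..b} \<inter> {..<b} - {t}"
      using sub[OF b(1)] J(3) by auto
    then have "at t within J = at t within {0..b}"
      using b by (intro at_within_nhd[of t "{..<b}"]) auto
    then show ?thesis
      using b by (intro that[of b]) auto
  next
    case False
    then have "J = {0..t}"
      using J(3) sub[OF t] by (intro equalityI subsetI) (auto simp: not_less)
    then show ?thesis
      using that[of t] t by auto
  qed
  have "((\<lambda>t. integral {0..t} f) has_vector_derivative f t) (at t within {0..b})"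
    using b J(3) t sub[OF b(1)]
    by (intro integral_has_vector_derivative continuous_on_subset[OF f]) auto
  then show ?thesis
    by (simp add: b(3))
qed

text \<open>Splitting the kernel into a factor in t and a factor in s moves the dependence on t in
  front of the integral. The product rule and the fundamental theorem then apply.\<close>

lemma damping_op_has_vector_derivative:
  assumes J: "is_interval J" "0 \<in> J" "J \<subseteq> {0..}" and f: "continuous_on J f" and t: "t \<in> J"
  shows "(damping_op \<kappa> f has_vector_derivative f t - \<kappa> * damping_op \<kappa> f t) (at t within J)"
proof -
  define F where "F t = integral {0..t} (\<lambda>s. exp (\<kappa> * s) * f s)" for t
  have eq: "damping_op \<kappa> f = (\<lambda>t. exp (- \<kappa> * t) * F t)"
  proof
    fix t
    have "(\<lambda>s. exp (- \<kappa> * (t - s)) * f s) = (\<lambda>s. exp (- \<kappa> * t) * (exp (\<kappa> * s) * f s))"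
      by (auto simp: algebra_simps simp flip: exp_add)
    then show "damping_op \<kappa> f t = exp (- \<kappa> * t) * F t"
      unfolding damping_op_def F_def by simp
  qed
  have F: "(F has_vector_derivative exp (\<kappa> * t) * f t) (at t within J)"
    unfolding F_def
    by (rule integral_from_0_has_vector_derivative[OF J _ t]) (intro continuous_intros f)
  have e: "((\<lambda>t. exp (- \<kappa> * t)) has_vector_derivative - \<kappa> * exp (- \<kappa> * t)) (at t within J)"
    by (auto intro!: derivative_eq_intros simp flip: has_real_derivative_iff_has_vector_derivative)
  have "exp (- \<kappa> * t) * exp (\<kappa> * t) = 1"
    by (simp flip: exp_add)
  then have "exp (- \<kappa> * t) * (exp (\<kappa> * t) * f t) + (- \<kappa> * exp (- \<kappa> * t)) * F t
      = f t - \<kappa> * (exp (- \<kappa> * t) * F t)"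
    by (simp flip: mult.assoc)
  then show ?thesis
    unfolding eq using has_vector_derivative_mult[OF e F] by (simp only:)
qed

text \<open>Bootstrap on the differential equation: its right-hand side is as regular as
  \<open>damping_op \<kappa> f\<close> and \<open>f\<close> are known to be, and this gives one more
  derivative of \<open>damping_op \<kappa> f\<close> for as long as \<open>f\<close> allows.\<close>

lemma Cn_damping_op:
  assumes J: "is_interval J" "0 \<in> J" "J \<subseteq> {0..}" "J \<noteq> {0}" and D: "open D" "x0 \<in> D"
    and f: "Cn_up_to_boundary n J D (\<lambda>t x. f t)"
  shows "Cn_up_to_boundary n J D (\<lambda>t x. damping_op \<kappa> f t)"
  using f
proof (induction n)
  case 0
  have "continuous_on J (damping_op \<kappa> f)"
    using damping_op_has_vector_derivative[OF J(1-3) Cn_time_cont[OF D(2) 0]]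
    by (meson continuous_on_eq_continuous_within has_vector_derivative_continuous)
  then show ?case
    by (rule Cn_0_time)
next
  case (Suc n)
  note nt = at_within_time_nontrivial[OF J(1,2,4)]
  have "Cn_up_to_boundary n J D (\<lambda>t x. 1 * f t + (- \<kappa>) * damping_op \<kappa> f t)"
    using Suc by (intro Cn_lincomb[OF D(1) nt] Cn_Suc_imp[OF Suc.prems]) (auto intro: Cn_Suc_imp)
  then show ?case
    using damping_op_has_vector_derivative[OF J(1-3) Cn_time_cont[OF D(2) Suc.prems]]
    by (intro Cn_Suc_time[OF nt D(1), where f' = "\<lambda>t. f t - \<kappa> * damping_op \<kappa> f t"]) auto
qed

section \<open>Time regularity of the mean elevation\<close>

lemma closure_ext_plus: "r < l \<Longrightarrow> closure (ext_plus r l) = {r..l}"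
  by (simp add: ext_plus_def)

text \<open>The end points do not affect the integral. This permits passing to the closed interval,
  on which the continuous extension \<open>g\<close> of \<open>f\<close> lives.\<close>

lemma integral_ext_plus:
  fixes f g :: "real \<Rightarrow> real"
  assumes "\<And>x. x \<in> ext_plus r l \<Longrightarrow> f x = g x"
  shows "integral (ext_plus r l) f = integral {r..l} g"
proof -
  have "integral (ext_plus r l) f = integral (box r l) g"
    using assms by (auto simp: ext_plus_def intro: integral_cong)
  then show ?thesis
    using integral_open_interval[of r l g] by simp
qed

text \<open>Writing the elevation as its initial value plus the time integral of its time
  derivative, and exchanging the two integrations, turns the mean into a constant plus an integral
  from 0 to t of a continuous function.\<close>

lemma mean_plus_has_vector_derivative:
  assumes J: "is_interval J" "0 \<in> J" "J \<subseteq> {0..}" and rl: "r < l"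
    and \<zeta>: "differentiable_tx J (ext_plus r l) \<zeta>" "cont_up_to_boundary J (ext_plus r l) \<zeta>"
      "cont_up_to_boundary J (ext_plus r l) (pd_t J \<zeta>)"
    and t: "t \<in> J"
  shows "(mean_plus r l \<zeta> has_vector_derivative mean_plus r l (pd_t J \<zeta>) t) (at t within J)"
proof -
  obtain Z where Z: "continuous_on (J \<times> {r..l}) (\<lambda>(t, x). Z t x)"
      "\<And>t x. t \<in> J \<Longrightarrow> x \<in> ext_plus r l \<Longrightarrow> Z t x = \<zeta> t x"
    using \<zeta>(2) rl by (auto simp: cont_up_to_boundary_def closure_ext_plus)
  obtain W where W: "continuous_on (J \<times> {r..l}) (\<lambda>(t, x). W t x)"
      "\<And>t x. t \<in> J \<Longrightarrow> x \<in> ext_plus r l \<Longrightarrow> W t x = pd_t J \<zeta> t x"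
    using \<zeta>(3) rl by (auto simp: cont_up_to_boundary_def closure_ext_plus)
  define N where "N s = integral {r..l} (W s)" for s
  have contN: "continuous_on J N"
    unfolding N_def using integral_continuous_on_param[of J r l W] W(1) by simp
  have sub: "{0..b} \<subseteq> J" if "b \<in> J" for b
    using mem_is_interval_1_I[OF J(1,2) that] by auto
  \<comment> \<open>Extensions to the closed interval replace the elevation and its time derivative,
    because the integrals over \<open>{r..l}\<close> require continuity at the end points, where
    \<open>\<zeta>\<close> is not controlled.\<close>
  have M: "integral (ext_plus r l) (\<zeta> s) = integral {r..l} (Z 0) + integral {0..s} N" if s: "s \<in> J" for s
  proof -
    define G where "G x = integral {0..s} (\<lambda>\<tau>. W \<tau> x)" for x
    have "continuous_on ({r..l} \<times> {0..s}) (\<lambda>p. (\<lambda>(t, x). W t x) (snd p, fst p))"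
      using sub[OF s] by (intro continuous_on_compose2[OF W(1)] continuous_intros) auto
    then have cW: "continuous_on ({r..l} \<times> {0..s}) (\<lambda>(x, \<tau>). W \<tau> x)"
      by (simp add: case_prod_unfold)
    then have cG: "continuous_on {r..l} G"
      unfolding G_def using integral_continuous_on_param[of "{r..l}" 0 s "\<lambda>x \<tau>. W \<tau> x"] by simp
    have "continuous_on {r..l} (\<lambda>x. (\<lambda>(t, x). Z t x) (0, x))"
      using J by (intro continuous_on_compose2[OF Z(1)] continuous_intros) auto
    then have cZ: "continuous_on {r..l} (Z 0)"
      by simp
    have "\<zeta> s x = Z 0 x + G x" if x: "x \<in> ext_plus r l" for x
    proof -
      have "((\<lambda>\<tau>. \<zeta> \<tau> x) has_vector_derivative W \<tau> x) (at \<tau> within {0..s})" if "\<tau> \<in> {0..s}" for \<tau>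
      proof -
        have "\<tau> \<in> J"
          using that sub[OF s] by auto
        then have "((\<lambda>\<tau>. \<zeta> \<tau> x) has_vector_derivative W \<tau> x) (at \<tau> within J)"
          using \<zeta>(1) x by (simp add: W(2) pd_t_def differentiable_tx_def vector_derivative_works)
        then show ?thesis
          by (rule has_vector_derivative_within_subset[OF _ sub[OF s]])
      qed
      then have "((\<lambda>\<tau>. W \<tau> x) has_integral (\<zeta> s x - \<zeta> 0 x)) {0..s}"
        using s J(3) by (intro fundamental_theorem_of_calculus) auto
      then show ?thesis
        using Z(2)[OF J(2) x] by (simp add: G_def integral_unique)
    qed
    then have "integral (ext_plus r l) (\<zeta> s) = integral {r..l} (\<lambda>x. Z 0 x + G x)"
      by (rule integral_ext_plus)
    also have "\<dots> = integral {r..l} (Z 0) + integral {r..l} G"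
      by (intro integral_add integrable_continuous_real cZ cG)
    \<comment> \<open>Fubini for the continuous function \<open>W\<close> on the rectangle
      \<open>{r..l}\<close> times \<open>{0..s}\<close>.\<close>
    also have "integral {r..l} G = integral {0..s} N"
      using integral_swap_continuous[of r 0 l s "\<lambda>x \<tau>. W \<tau> x"] cW
      by (simp add: G_def[abs_def] N_def[abs_def] cbox_Pair_eq)
    finally show ?thesis .
  qed
  have "((\<lambda>s. 1 / (l - r) * (integral {r..l} (Z 0) + integral {0..s} N)) has_vector_derivative
      1 / (l - r) * (0 + N t)) (at t within J)"
    by (intro has_vector_derivative_mult_right has_vector_derivative_add has_vector_derivative_const
        integral_from_0_has_vector_derivative[OF J contN t])
  then have "(mean_plus r l \<zeta> has_vector_derivative 1 / (l - r) * (0 + N t)) (at t within J)"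
    by (rule has_vector_derivative_transform[OF t, rotated]) (simp add: mean_plus_def M)
  moreover have "N t = integral (ext_plus r l) (pd_t J \<zeta> t)"
    unfolding N_def by (rule integral_ext_plus[symmetric]) (simp add: W(2) t)
  ultimately show ?thesis
    by (simp add: mean_plus_def)
qed

text \<open>The time derivative of the mean is the mean of the time derivative, so the induction
  runs over all elevations. The set \<open>D\<close> is free because the mean does not depend on
  x.\<close>

lemma Cn_mean_plus:
  assumes J: "is_interval J" "0 \<in> J" "J \<subseteq> {0..}" "J \<noteq> {0}" and rl: "r < l" and D: "open D"
    and \<zeta>: "Cn_up_to_boundary n J (ext_plus r l) \<zeta>"
  shows "Cn_up_to_boundary n J D (\<lambda>t x. mean_plus r l \<zeta> t)"
  using \<zeta>
proof (induction n arbitrary: \<zeta>)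
  case (0 \<zeta>)
  then obtain Z where Z: "continuous_on (J \<times> {r..l}) (\<lambda>(t, x). Z t x)"
      "\<And>t x. t \<in> J \<Longrightarrow> x \<in> ext_plus r l \<Longrightarrow> Z t x = \<zeta> t x"
    using rl by (auto simp: Cn_0 cont_up_to_boundary_def closure_ext_plus)
  have "continuous_on J (\<lambda>t. 1 / (l - r) * integral {r..l} (Z t))"
    using integral_continuous_on_param[of J r l Z] Z(1) by (intro continuous_intros) simp
  then have "continuous_on J (mean_plus r l \<zeta>)"
  proof (rule continuous_on_eq)
    fix t assume "t \<in> J"
    then show "1 / (l - r) * integral {r..l} (Z t) = mean_plus r l \<zeta> t"
      unfolding mean_plus_def by (subst integral_ext_plus[of r l _ "Z t"]) (auto simp: Z(2))
  qed
  then show ?case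
    by (rule Cn_0_time)
next
  case (Suc n \<zeta>)
  then show ?case
    using at_within_time_nontrivial[OF J(1,2,4)] D J rl
    by (intro Cn_Suc_time[where f' = "mean_plus r l (pd_t J \<zeta>)"] mean_plus_has_vector_derivative)
       (auto simp: Cn_Suc intro: Cn_imp_cont)
qed

section \<open>Traces and jumps\<close>

lemma trace_eqI:
  assumes "(G \<longlongrightarrow> L) (at a within D)" "a islimpt D"
  shows "trace D a G = L"
  unfolding trace_def using assms by (intro tendsto_Lim) (simp_all add: trivial_limit_within)

text \<open>\<open>Lim\<close> is a description of the limit, so equivalence of the limit statements
  for each \<open>L\<close> gives equal traces whether or not a limit exists.\<close>

lemma trace_cong:
  assumes "\<And>x. x \<in> D \<Longrightarrow> G x = G' x"
  shows "trace D a G = trace D a G'"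
proof -
  have "(G \<longlongrightarrow> L) (at a within D) \<longleftrightarrow> (G' \<longlongrightarrow> L) (at a within D)" for L
    by (rule tendsto_cong) (use assms in \<open>auto simp: eventually_at_filter\<close>)
  then show ?thesis
    by (simp add: trace_def Topological_Spaces.Lim_def)
qed

text \<open>As r is positive, the open half lines on either side of 0 separate the two exterior
  pieces, and only one piece is seen near each of the two points.\<close>

lemma trace_exterior:
  assumes "0 < r" "r < l"
  shows "trace (exterior_dom r l) r = trace (ext_plus r l) r"
    and "trace (exterior_dom r l) (-r) = trace (ext_minus r) (-r)"
proof -
  have "at r within exterior_dom r l = at r within ext_plus r l"
    using assms
    by (intro at_within_nhd[of r "{0<..}"]) (auto simp: exterior_dom_def ext_minus_def ext_plus_def)
  moreover have "at (-r) within exterior_dom r l = at (-r) within ext_minus r"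
    using assms
    by (intro at_within_nhd[of "-r" "{..<0}"]) (auto simp: exterior_dom_def ext_minus_def ext_plus_def)
  ultimately show "trace (exterior_dom r l) r = trace (ext_plus r l) r"
    "trace (exterior_dom r l) (-r) = trace (ext_minus r) (-r)"
    by (auto simp: trace_def fun_eq_iff)
qed

lemma islimpt_domains:
  assumes "0 < r" "r < l"
  shows "r islimpt ext_plus r l" "-r islimpt ext_minus r"
    "r islimpt interior_dom r" "-r islimpt interior_dom r"
  using assms
  by (simp_all add: ext_plus_def ext_minus_def interior_dom_def islimpt_in_closure)

lemma cont_up_to_boundary_tendsto:
  assumes "cont_up_to_boundary J D u" "t \<in> J" "a islimpt D"
  shows "\<exists>L. (u t \<longlongrightarrow> L) (at a within D)"
proof -
  obtain v where v: "continuous_on (J \<times> closure D) (\<lambda>(t, x). v t x)" "\<And>x. x \<in> D \<Longrightarrow> v t x = u t x"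
    using assms(1,2) by (auto simp: cont_up_to_boundary_def)
  have "continuous_on (closure D) (\<lambda>x. (\<lambda>(t, x). v t x) (t, x))"
    using assms by (intro continuous_on_compose2[OF v(1)] continuous_intros) auto
  then have "continuous_on (closure D) (v t)"
    by simp
  moreover have "a \<in> closure D"
    using assms(3) by (simp add: closure_def)
  ultimately have "(v t \<longlongrightarrow> v t a) (at a within closure D)"
    by (simp add: continuous_on_def)
  then have "(v t \<longlongrightarrow> v t a) (at a within D)"
    by (rule tendsto_within_subset) (rule closure_subset)
  moreover have "\<forall>\<^sub>F x in at a within D. v t x = u t x"
    by (simp add: eventually_at_filter v(2))
  ultimately show ?thesis
    using tendsto_cong by blast
qed

text \<open>The lower bound on the depth survives the passage to the limit, so the denominators in
  \<open>frakE\<close> stay away from zero at the boundary. Pointwise positivity inside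
  \<open>D\<close> would not ensure this.\<close>

lemma head_tendsto:
  assumes cont: "cont_up_to_boundary J D \<zeta>" "cont_up_to_boundary J D q"
      "cont_up_to_boundary J D (pd_x (pd_t J q))"
    and depth: "positive_depth \<epsilon> J D \<zeta>" and t: "t \<in> J" and a: "a islimpt D"
  shows "\<exists>L. ((\<lambda>x. \<zeta> t x + frakE \<epsilon> \<mu>' J \<zeta> q t x) \<longlongrightarrow> L) (at a within D)"
proof -
  obtain z p s where lim: "(\<zeta> t \<longlongrightarrow> z) (at a within D)" "(q t \<longlongrightarrow> p) (at a within D)"
      "(pd_x (pd_t J q) t \<longlongrightarrow> s) (at a within D)"
    using cont_up_to_boundary_tendsto[OF _ t a] cont by meson
  obtain c where c: "c > 0" "\<And>x. x \<in> D \<Longrightarrow> c \<le> depth \<epsilon> \<zeta> t x"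
    using depth t by (auto simp: positive_depth_def)
  have h: "(depth \<epsilon> \<zeta> t \<longlongrightarrow> 1 + \<epsilon> * z) (at a within D)"
    unfolding depth_def by (intro tendsto_intros lim)
  have "c \<le> 1 + \<epsilon> * z"
    by (rule tendsto_lowerbound[OF h])
       (use a c in \<open>auto simp: eventually_at_filter trivial_limit_within\<close>)
  with c have "1 + \<epsilon> * z \<noteq> 0"
    by simp
  then have "((\<lambda>x. \<zeta> t x + frakE \<epsilon> \<mu>' J \<zeta> q t x) \<longlongrightarrow>
      z + (\<epsilon> * p\<^sup>2 / (2 * (1 + \<epsilon> * z)\<^sup>2) - \<mu>'\<^sup>2 * (s / (1 + \<epsilon> * z)))) (at a within D)"
    unfolding frakE_def by (intro tendsto_intros lim h) auto
  then show ?thesis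
    by blast
qed

text \<open>Additivity of \<open>Lim\<close> requires limits to exist, hence the assumptions on
  \<open>G\<close>. The pressure has trace \<open>p\<close> on the right and 0 on the left.\<close>

lemma jump_exterior_add:
  assumes rl: "0 < r" "r < l"
    and G: "\<exists>L. (G \<longlongrightarrow> L) (at r within ext_plus r l)" "\<exists>L. (G \<longlongrightarrow> L) (at (-r) within ext_minus r)"
    and P: "\<And>x. x \<in> ext_minus r \<Longrightarrow> P x = 0" "\<And>x. x \<in> ext_plus r l \<Longrightarrow> P x = p"
  shows "jump r (exterior_dom r l) (\<lambda>x. G x + P x) = jump r (exterior_dom r l) G + p"
proof -
  obtain L M where LM: "(G \<longlongrightarrow> L) (at r within ext_plus r l)" "(G \<longlongrightarrow> M) (at (-r) within ext_minus r)"
    using G by blast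
  note lim = islimpt_domains[OF rl]
  have "trace (ext_plus r l) r (\<lambda>x. G x + P x) = trace (ext_plus r l) r (\<lambda>x. G x + p)"
    "trace (ext_minus r) (-r) (\<lambda>x. G x + P x) = trace (ext_minus r) (-r) G"
    by (rule trace_cong; simp add: P)+
  moreover have "trace (ext_plus r l) r (\<lambda>x. G x + p) = L + p"
    "trace (ext_plus r l) r G = L" "trace (ext_minus r) (-r) G = M"
    by (rule trace_eqI; (intro tendsto_intros LM lim)?)+
  ultimately show ?thesis
    by (simp add: jump_def trace_exterior[OF rl])
qed

lemma jump_interior_affine:
  assumes "0 < r" "\<And>x. x \<in> interior_dom r \<Longrightarrow> G x = c + m * x"
  shows "jump r (interior_dom r) G = 2 * r * m"
proof -
  have "trace (interior_dom r) a G = c + m * a" if "a islimpt interior_dom r" for a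
  proof -
    have "trace (interior_dom r) a G = trace (interior_dom r) a (\<lambda>x. c + m * x)"
      by (rule trace_cong[OF assms(2)])
    also have "\<dots> = c + m * a"
      by (rule trace_eqI[OF _ that]) (intro tendsto_intros)
    finally show ?thesis .
  qed
  then show ?thesis
    \<comment> \<open>The facts on the interior do not mention \<open>l\<close>; any value above
      \<open>r\<close> will do for it.\<close>
    using islimpt_domains(3,4)[of r "r + 1"] assms(1) by (simp add: jump_def algebra_simps)
qed

lemma frakE_cong:
  assumes "open D" "t \<in> J" "x \<in> D"
    and "\<And>t x. t \<in> J \<Longrightarrow> x \<in> D \<Longrightarrow> \<zeta>' t x = \<zeta> t x" "\<And>t x. t \<in> J \<Longrightarrow> x \<in> D \<Longrightarrow> q' t x = q t x"
  shows "frakE \<epsilon> \<mu>' J \<zeta>' q' t x = frakE \<epsilon> \<mu>' J \<zeta> q t x"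
proof -
  have "pd_x (pd_t J q') t x = pd_x (pd_t J q) t x"
    by (rule pd_x_cong[OF assms(1,3)], rule pd_t_cong) (use assms in auto)
  then show ?thesis
    using assms by (simp add: frakE_def depth_def)
qed

lemma jump_cong: "(\<And>x. x \<in> D \<Longrightarrow> G x = G' x) \<Longrightarrow> jump r D G = jump r D G'"
  unfolding jump_def using trace_cong by metis

section \<open>Equivalence of the two problems\<close>

lemma pd_x_const:
  assumes "open D" "x \<in> D" "\<And>y. y \<in> D \<Longrightarrow> u t y = c"
  shows "pd_x u t x = 0"
proof -
  have "pd_x u t x = pd_x (\<lambda>t x. c) t x"
    by (rule pd_x_cong[OF assms(1,2)]) (rule assms(3))
  also have "\<dots> = 0"
    by (rule pd_x_eqI) simp
  finally show ?thesis .
qed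

text \<open>After subtraction of m x the derivative vanishes on a convex set. The case m = 0 gives
  the interior discharge, the general case the interior pressure.\<close>

lemma pd_x_const_imp_affine:
  assumes "differentiable_tx J D u" "convex D" "t \<in> J" "\<And>x. x \<in> D \<Longrightarrow> pd_x u t x = m"
  shows "\<exists>c. \<forall>x\<in>D. u t x = c + m * x"
proof -
  have "((\<lambda>x. u t x - m * x) has_field_derivative 0) (at x within D)" if "x \<in> D" for x
  proof -
    have "(u t has_field_derivative m) (at x)"
      using assms(1,3) assms(4)[OF that] that
      by (auto simp: differentiable_tx_def pd_x_def simp flip: DERIV_deriv_iff_real_differentiable)
    from DERIV_diff[OF this DERIV_cmult_Id[of m x]]
    show ?thesis
      by (simp add: has_field_derivative_at_within)
  qed
  then obtain c where "\<forall>x\<in>D. u t x - m * x = c"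
    using has_field_derivative_zero_constant[OF assms(2)] by metis
  then show ?thesis
    by (intro exI[of _ c]) (auto simp: algebra_simps)
qed

lemma open_domains:
  "open (interior_dom r)" "open (ext_minus r)" "open (ext_plus r l)" "open (exterior_dom r l)"
  by (auto simp: interior_dom_def ext_minus_def ext_plus_def exterior_dom_def)

text \<open>These identities reduce the left-hand side of the interior momentum equation to the time
  derivative of \<open>qi\<close>.\<close>

lemma constant_state_derivs:
  assumes \<zeta>: "\<And>t x. t \<in> J \<Longrightarrow> x \<in> D \<Longrightarrow> \<zeta> t x = \<zeta>w"
    and q: "\<And>t x. t \<in> J \<Longrightarrow> x \<in> D \<Longrightarrow> q t x = qi t"
    and D: "open D" "t \<in> J" "x \<in> D"
  shows "pd_t J q t x = vector_derivative qi (at t within J)"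
    and "pd_x q t x = 0" and "pd_x \<zeta> t x = 0"
    and "pd_x (pd_x (pd_t J q)) t x = 0"
    and "pd_x (\<lambda>t x. (q t x)\<^sup>2 / depth \<epsilon> \<zeta> t x) t x = 0"
proof -
  have qt: "pd_t J q t y = vector_derivative qi (at t within J)" if "y \<in> D" for y
  proof -
    have "pd_t J q t y = pd_t J (\<lambda>t x. qi t) t y"
      by (rule pd_t_cong) (use q D that in auto)
    then show ?thesis
      by (simp add: pd_t_def)
  qed
  then show "pd_t J q t x = vector_derivative qi (at t within J)"
    using D by blast
  have "pd_x (pd_t J q) t y = 0" if "y \<in> D" for y
    by (rule pd_x_const[OF D(1) that]) (rule qt)
  then show "pd_x (pd_x (pd_t J q)) t x = 0"
    by (rule pd_x_const[OF D(1,3)]) blast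
  show "pd_x q t x = 0" "pd_x \<zeta> t x = 0"
    by (rule pd_x_const[OF D(1,3)]; use q \<zeta> D in blast)+
  show "pd_x (\<lambda>t x. (q t x)\<^sup>2 / depth \<epsilon> \<zeta> t x) t x = 0"
    by (rule pd_x_const[OF D(1,3), where c = "(qi t)\<^sup>2 / (1 + \<epsilon> * \<zeta>w)"])
       (use q \<zeta> D in \<open>auto simp: depth_def\<close>)
qed

lemma constant_state_pd_t:
  assumes "\<And>t x. t \<in> J \<Longrightarrow> x \<in> D \<Longrightarrow> \<zeta> t x = \<zeta>w" "t \<in> J" "x \<in> D" "at t within J \<noteq> bot"
  shows "pd_t J \<zeta> t x = 0"
proof -
  have "pd_t J \<zeta> t x = pd_t J (\<lambda>t x. \<zeta>w) t x"
    by (rule pd_t_cong) (use assms in auto)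
  also have "\<dots> = 0"
    by (rule pd_t_eqI[OF _ assms(4)]) simp
  finally show ?thesis .
qed

lemma Cn_imp_cont_pd_x_pd_t:
  assumes "Cn_up_to_boundary n J D u" "2 \<le> n"
  shows "cont_up_to_boundary J D (pd_x (pd_t J u))"
proof -
  obtain m where "n = Suc (Suc m)"
    using assms(2) by (metis Suc_le_D numeral_2_eq_2 Suc_le_mono)
  then show ?thesis
    using assms(1) by (auto simp: Cn_Suc intro: Cn_imp_cont)
qed

text \<open>Both directions read the right-hand side of the coupling condition in this form. Two
  derivatives are required because \<open>frakE\<close> contains a mixed second derivative of the
  discharge, which must have a trace.\<close>

lemma jump_head_pressure:
  assumes rl: "0 < r" "r < l" and n: "2 \<le> n" and t: "t \<in> J"
    and reg: "\<And>D. D \<in> {ext_minus r, ext_plus r l} \<Longrightarrow>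
      Cn_up_to_boundary n J D \<zeta> \<and> Cn_up_to_boundary n J D q \<and> positive_depth \<epsilon> J D \<zeta>"
    and P: "\<And>x. x \<in> ext_minus r \<Longrightarrow> P t x = 0" "\<And>x. x \<in> ext_plus r l \<Longrightarrow> P t x = p"
  shows "jump r (exterior_dom r l) (\<lambda>x. \<zeta> t x + frakE \<epsilon> \<mu>' J \<zeta> q t x + P t x / \<epsilon>) =
    jump r (exterior_dom r l) (\<lambda>x. \<zeta> t x + frakE \<epsilon> \<mu>' J \<zeta> q t x) + p / \<epsilon>"
proof -
  have "\<exists>L. ((\<lambda>x. \<zeta> t x + frakE \<epsilon> \<mu>' J \<zeta> q t x) \<longlongrightarrow> L) (at a within D)"
    if "D \<in> {ext_minus r, ext_plus r l}" "a islimpt D" for a D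
    using reg[OF that(1)] n t that(2)
    by (intro head_tendsto) (auto intro: Cn_imp_cont Cn_imp_cont_pd_x_pd_t)
  then show ?thesis
    using islimpt_domains[OF rl] P by (intro jump_exterior_add[OF rl]) auto
qed

lemma mean_plus_cong:
  assumes "\<And>x. x \<in> ext_plus r l \<Longrightarrow> \<zeta>' t x = \<zeta> t x"
  shows "mean_plus r l \<zeta>' t = mean_plus r l \<zeta> t"
  unfolding mean_plus_def using assms integral_cong[of "ext_plus r l" "\<zeta>' t" "\<zeta> t"] by simp

section \<open>The two directions, with the parameters of the problem fixed\<close>

context
  fixes \<epsilon> \<mu> \<mu>' r l P0 \<kappa> \<zeta>w \<alpha> :: real and J :: "real set" and n :: nat
  assumes eps: "0 < \<epsilon>"
    and mu: "0 \<le> \<mu>"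
    and rl: "0 < r" "r < l"
    and hw: "0 < 1 + \<epsilon> * \<zeta>w"
    and mu': "\<mu>' = sqrt (\<mu> / 3)"
    and alpha: "\<alpha> = 2 * r / (1 + \<epsilon> * \<zeta>w)"
    and time: "is_interval J" "0 \<in> J" "J \<subseteq> {0..}" "J \<noteq> {0}"
    and n: "3 \<le> n"
begin

lemma mu'_square: "\<mu>'\<^sup>2 = \<mu> / 3"
  using mu by (simp add: mu')

lemmas time_nontrivial = at_within_time_nontrivial[OF time(1,2,4)]

lemma constrained_imp_interior_discharge:
  assumes reg: "regular_constrained n r l J \<zeta> q P"
    and model: "constrained_model \<epsilon> \<mu> r l P0 \<kappa> \<zeta>w J \<zeta> q P"
  shows "\<exists>qi. interior_discharge r J q qi"
proof -
  let ?I = "interior_dom r"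
  obtain m where m: "n = Suc m"
    using n by (cases n) auto
  have diff: "differentiable_tx J ?I q"
    using reg by (auto simp: regular_constrained_def m Cn_Suc)
  have \<zeta>: "\<And>t x. t \<in> J \<Longrightarrow> x \<in> ?I \<Longrightarrow> \<zeta> t x = \<zeta>w"
    and mass: "\<And>t x. t \<in> J \<Longrightarrow> x \<in> ?I \<Longrightarrow> pd_t J \<zeta> t x + pd_x q t x = 0"
    using model by (auto simp: constrained_model_def)
  have "\<exists>c. \<forall>x\<in>?I. q t x = c" if t: "t \<in> J" for t
  proof -
    have "pd_x q t x = 0" if "x \<in> ?I" for x
      using mass[OF t that] constant_state_pd_t[of J ?I \<zeta>, OF \<zeta> t that time_nontrivial[OF t]] by simp
    then show ?thesis
      using pd_x_const_imp_affine[OF diff _ t, of 0] by (simp add: interior_dom_def)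
  qed
  then show ?thesis
    unfolding interior_discharge_def by metis
qed

lemma constrained_imp_transmission:
  assumes reg: "regular_constrained n r l J \<zeta> q P"
    and model: "constrained_model \<epsilon> \<mu> r l P0 \<kappa> \<zeta>w J \<zeta> q P"
    and qi: "interior_discharge r J q qi"
    and cont: "discharge_continuity r l J q qi"
    and energy: "energy_coupling \<epsilon> \<mu>' r l J \<zeta> q P"
  shows "regular_transmission n r l J \<zeta> q qi" "transmission_problem \<epsilon> \<mu>' r l P0 \<kappa> \<alpha> J \<zeta> q qi"
proof -
  let ?I = "interior_dom r" and ?E = "exterior_dom r l"
  let ?p = "\<lambda>t. \<epsilon> * P0 * (mean_plus r l \<zeta> t - \<kappa> * damping_op \<kappa> (mean_plus r l \<zeta>) t)"
  have q_I: "\<And>t x. t \<in> J \<Longrightarrow> x \<in> ?I \<Longrightarrow> q t x = qi t"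
    using qi by (simp add: interior_discharge_def)
  have "Cn_up_to_boundary n J ?I q"
    using reg by (simp add: regular_constrained_def)
  then have "Cn_up_to_boundary n J ?I (\<lambda>t x. qi t)"
    by (rule Cn_cong[OF open_domains(1), rotated]) (simp add: q_I)
  then show "regular_transmission n r l J \<zeta> q qi"
    using reg by (simp add: regular_constrained_def regular_transmission_def)

  have \<zeta>_I: "\<And>t x. t \<in> J \<Longrightarrow> x \<in> ?I \<Longrightarrow> \<zeta> t x = \<zeta>w"
    and P_minus: "\<And>t x. t \<in> J \<Longrightarrow> x \<in> ext_minus r \<Longrightarrow> P t x = 0"
    and P_plus: "\<And>t x. t \<in> J \<Longrightarrow> x \<in> ext_plus r l \<Longrightarrow> P t x = ?p t"
    using model by (auto simp: constrained_model_def)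
  have momentum: "pd_t J q t x - \<mu> / 3 * pd_x (pd_x (pd_t J q)) t x
             + \<epsilon> * pd_x (\<lambda>t x. (q t x)\<^sup>2 / depth \<epsilon> \<zeta> t x) t x
             + depth \<epsilon> \<zeta> t x * pd_x \<zeta> t x
           = - depth \<epsilon> \<zeta> t x / \<epsilon> * pd_x P t x"
    and mass: "pd_t J \<zeta> t x + pd_x q t x = 0"
    if "D \<in> {ext_minus r, ?I, ext_plus r l}" "t \<in> J" "x \<in> D" for D t x
    using model that unfolding constrained_model_def by blast+
  have pos: "positive_depth \<epsilon> J D \<zeta>" if "D \<in> {ext_minus r, ext_plus r l}" for D
    using model that unfolding constrained_model_def by blast

  \<comment> \<open>Each exterior piece has its own lower bound; the smaller one serves on the
    union.\<close>
  have "positive_depth \<epsilon> J ?E \<zeta>"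
    unfolding positive_depth_def
  proof
    fix t assume "t \<in> J"
    then obtain c d where "c > 0" "\<forall>x\<in>ext_minus r. c \<le> depth \<epsilon> \<zeta> t x"
        "d > 0" "\<forall>x\<in>ext_plus r l. d \<le> depth \<epsilon> \<zeta> t x"
      using pos[of "ext_minus r"] pos[of "ext_plus r l"] by (auto simp: positive_depth_def) metis
    then show "\<exists>c>0. \<forall>x\<in>?E. c \<le> depth \<epsilon> \<zeta> t x"
      by (intro exI[of _ "min c d"]) (auto simp: exterior_dom_def min_le_iff_disj)
  qed
  moreover have "pd_t J \<zeta> t x + pd_x q t x = 0 \<and>
      pd_t J q t x - \<mu>'\<^sup>2 * pd_x (pd_x (pd_t J q)) t x
        + \<epsilon> * pd_x (\<lambda>t x. (q t x)\<^sup>2 / depth \<epsilon> \<zeta> t x) t x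
        + depth \<epsilon> \<zeta> t x * pd_x \<zeta> t x = 0" if t: "t \<in> J" and x: "x \<in> ?E" for t x
  proof -
    obtain D where D: "D \<in> {ext_minus r, ext_plus r l}" "x \<in> D"
      using x by (auto simp: exterior_dom_def)
    have "pd_x P t x = 0"
    proof (cases "D = ext_minus r")
      case True
      then show ?thesis
        using D P_minus[OF t] by (intro pd_x_const[OF open_domains(2)[of r]]) auto
    next
      case False
      then show ?thesis
        using D P_plus[OF t] by (intro pd_x_const[OF open_domains(3)[of r l]]) auto
    qed
    then show ?thesis
      using momentum[OF _ t D(2)] mass[OF _ t D(2)] D(1) by (auto simp: mu'_square)
  qed
  moreover have "decay_bc J \<zeta> q" "wall_bc J r l q"
    using model by (auto simp: constrained_model_def)
  moreover have "jump r ?E (q t) = 0" "average r ?E (q t) = qi t" if "t \<in> J" for t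
    using cont that by (auto simp: discharge_continuity_def jump_def average_def)
  moreover have "\<alpha> * vector_derivative qi (at t within J) =
        - jump r ?E (\<lambda>x. \<zeta> t x + frakE \<epsilon> \<mu>' J \<zeta> q t x)
        - P0 * (mean_plus r l \<zeta> t - \<kappa> * damping_op \<kappa> (mean_plus r l \<zeta>) t)" if t: "t \<in> J" for t
  proof -
    let ?d = "vector_derivative qi (at t within J)"
    \<comment> \<open>The slope obtained by solving the interior momentum equation, without its
      vanishing terms, for the pressure gradient.\<close>
    let ?m = "- \<epsilon> / (1 + \<epsilon> * \<zeta>w) * ?d"
    have "pd_x P t x = ?m" if x: "x \<in> ?I" for x
    proof -
      have "?d = - (1 + \<epsilon> * \<zeta>w) / \<epsilon> * pd_x P t x"
        using momentum[of ?I t x] t x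
          constant_state_derivs[of J ?I \<zeta> \<zeta>w q qi t x, OF \<zeta>_I q_I open_domains(1) t x]
        by (simp add: depth_def \<zeta>_I)
      then show ?thesis
        using eps hw by (simp add: field_simps)
    qed
    \<comment> \<open>The pressure is of class n - 1 only, which is still at least 2.\<close>
    moreover have "differentiable_tx J ?I P"
    proof -
      obtain k where "n - 1 = Suc k"
        using n by (cases "n - 1") auto
      then show ?thesis
        using reg by (auto simp: regular_constrained_def Cn_Suc)
    qed
    ultimately obtain c where "\<forall>x\<in>?I. P t x = c + ?m * x"
      using pd_x_const_imp_affine[of J ?I P t ?m] t by (auto simp: interior_dom_def)
    then have "jump r ?I (P t) = 2 * r * ?m"
      using jump_interior_affine[OF rl(1)] by blast
    \<comment> \<open>The constant \<alpha> arises here: the slope is multiplied by the width 2 r of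
      the structure.\<close>
    have "jump r ?I (P t) / \<epsilon> = - (\<alpha> * ?d)"
    proof -
      have "2 * r * ?m = - (\<alpha> * ?d) * \<epsilon>"
        by (simp add: alpha)
      with \<open>jump r ?I (P t) = 2 * r * ?m\<close> show ?thesis
        using eps by (metis nonzero_mult_div_cancel_right less_irrefl)
    qed
    moreover have "jump r ?I (P t) / \<epsilon> = jump r ?E (\<lambda>x. \<zeta> t x + frakE \<epsilon> \<mu>' J \<zeta> q t x) + ?p t / \<epsilon>"
    proof -
      have "Cn_up_to_boundary n J D \<zeta> \<and> Cn_up_to_boundary n J D q \<and> positive_depth \<epsilon> J D \<zeta>"
        if "D \<in> {ext_minus r, ext_plus r l}" for D
        using that reg pos[OF that] by (auto simp: regular_constrained_def)
      then have "jump r ?E (\<lambda>x. \<zeta> t x + frakE \<epsilon> \<mu>' J \<zeta> q t x + P t x / \<epsilon>) =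
          jump r ?E (\<lambda>x. \<zeta> t x + frakE \<epsilon> \<mu>' J \<zeta> q t x) + ?p t / \<epsilon>"
        using n t P_minus P_plus by (intro jump_head_pressure[OF rl, of n]) auto
      then show ?thesis
        using energy t by (simp add: energy_coupling_def)
    qed
    ultimately show ?thesis
      using eps by simp
  qed
  ultimately show "transmission_problem \<epsilon> \<mu>' r l P0 \<kappa> \<alpha> J \<zeta> q qi"
    unfolding transmission_problem_def by blast
qed

text \<open>Inserting the interior state changes nothing on the exterior, so the requirements there
  carry over by congruence. What has to be constructed is the pressure.\<close>

lemma transmission_imp_constrained:
  assumes reg: "regular_transmission n r l J \<zeta> q qi"
    and trans: "transmission_problem \<epsilon> \<mu>' r l P0 \<kappa> \<alpha> J \<zeta> q qi"
  shows "\<exists>\<zeta>' q' P.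
           (\<forall>t\<in>J. \<forall>x\<in>exterior_dom r l. \<zeta>' t x = \<zeta> t x \<and> q' t x = q t x) \<and>
           (\<forall>t\<in>J. \<forall>x\<in>interior_dom r. \<zeta>' t x = \<zeta>w \<and> q' t x = qi t) \<and>
           regular_constrained n r l J \<zeta>' q' P \<and>
           constrained_model \<epsilon> \<mu> r l P0 \<kappa> \<zeta>w J \<zeta>' q' P \<and>
           discharge_continuity r l J q' qi \<and>
           energy_coupling \<epsilon> \<mu>' r l J \<zeta>' q' P"
proof -
  let ?I = "interior_dom r" and ?E = "exterior_dom r l"
  define d where "d t = vector_derivative qi (at t within J)" for t
  define p where "p t = \<epsilon> * P0 * (mean_plus r l \<zeta> t - \<kappa> * damping_op \<kappa> (mean_plus r l \<zeta>) t)" for t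
  define \<zeta>' where "\<zeta>' t x = (if x \<in> ?I then \<zeta>w else \<zeta> t x)" for t x
  define q' where "q' t x = (if x \<in> ?I then qi t else q t x)" for t x
  \<comment> \<open>The interior slope is dictated by the momentum equation. Only this slope and the
    jump of \<open>P\<close> matter there, so the additive constant is taken to be 0. Outside the
    interior the sign of x tells the two exterior pieces apart.\<close>
  define P where "P t x = (if x \<in> ?I then - \<epsilon> / (1 + \<epsilon> * \<zeta>w) * d t * x else if x < 0 then 0 else p t)" for t x
  have disjoint: "x \<notin> ?I" if "x \<in> ?E" for x
    using that rl by (auto simp: interior_dom_def exterior_dom_def ext_minus_def ext_plus_def)
  have subE: "D \<subseteq> ?E" if "D \<in> {ext_minus r, ext_plus r l}" for D
    using that by (auto simp: exterior_dom_def)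
  have \<zeta>'_E: "\<zeta>' t x = \<zeta> t x" and q'_E: "q' t x = q t x" if "x \<in> ?E" for t x
    using disjoint[OF that] by (auto simp: \<zeta>'_def q'_def)
  have \<zeta>'_I: "\<zeta>' t x = \<zeta>w" and q'_I: "q' t x = qi t"
    and P_I: "P t x = 0 + (- \<epsilon> / (1 + \<epsilon> * \<zeta>w) * d t) * x" if "x \<in> ?I" for t x
    using that by (auto simp: \<zeta>'_def q'_def P_def)
  have P_minus: "P t x = 0" if "x \<in> ext_minus r" for t x
    using that rl by (auto simp: P_def interior_dom_def ext_minus_def)
  have P_plus: "P t x = p t" if "x \<in> ext_plus r l" for t x
    using that rl by (auto simp: P_def interior_dom_def ext_plus_def)
  have mean: "mean_plus r l \<zeta>' = mean_plus r l \<zeta>"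
    using \<zeta>'_E by (intro ext mean_plus_cong) (auto simp: exterior_dom_def)
  obtain m where m: "n = Suc m"
    using n by (cases n) auto
  have zero_I: "0 \<in> ?I"
    using rl by (simp add: interior_dom_def)
  have Cn_qi: "Cn_up_to_boundary n J ?I (\<lambda>t x. qi t)"
    using reg by (simp add: regular_transmission_def)
  have Cn_E: "Cn_up_to_boundary n J D \<zeta>" "Cn_up_to_boundary n J D q"
    if "D \<in> {ext_minus r, ext_plus r l}" for D
    using reg that unfolding regular_transmission_def by blast+

  have Cn': "Cn_up_to_boundary n J D \<zeta>'" "Cn_up_to_boundary n J D q'"
    if D: "D \<in> {ext_minus r, ext_plus r l}" for D
  proof -
    have "open D"
      using D open_domains by auto
    then show "Cn_up_to_boundary n J D \<zeta>'" "Cn_up_to_boundary n J D q'"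
      using subE[OF D] by (auto intro: Cn_cong[OF _ _ Cn_E(1)[OF D]] Cn_cong[OF _ _ Cn_E(2)[OF D]]
          simp: \<zeta>'_E q'_E subset_eq)
  qed
  have Cn'_I: "Cn_up_to_boundary n J ?I \<zeta>'" "Cn_up_to_boundary n J ?I q'"
    by (rule Cn_cong[OF open_domains(1) _ Cn_const[OF time_nontrivial open_domains(1), where c = \<zeta>w]];
        simp add: \<zeta>'_I)
       (rule Cn_cong[OF open_domains(1) _ Cn_qi]; simp add: q'_I)
  have Cn_P_I: "Cn_up_to_boundary m J ?I P"
  proof -
    \<comment> \<open>Differentiating \<open>qi\<close> costs one order, which is the loss that
      \<open>regular_constrained\<close> allows for the pressure.\<close>
    have "Cn_up_to_boundary m J ?I (\<lambda>t x. d t)"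
      using Cn_time_deriv(1)[OF open_domains(1) zero_I] Cn_qi by (simp add: m d_def)
    \<comment> \<open>Multiplication by a constant, as a linear combination with second coefficient
      0.\<close>
    from Cn_lincomb[OF open_domains(1) time_nontrivial this this, of "- \<epsilon> / (1 + \<epsilon> * \<zeta>w)" 0]
    have "Cn_up_to_boundary m J ?I (\<lambda>t x. - \<epsilon> / (1 + \<epsilon> * \<zeta>w) * d t)"
      by simp
    from Cn_time_mult_x[OF time_nontrivial open_domains(1) zero_I this]
    show ?thesis
      by (rule Cn_cong[OF open_domains(1), rotated]) (simp_all add: P_I)
  qed
  have Cn_P_minus: "Cn_up_to_boundary m J (ext_minus r) P"
    by (rule Cn_cong[OF open_domains(2) _ Cn_const[OF time_nontrivial open_domains(2), where c = 0]])
       (simp_all add: P_minus)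
  have Cn_P_plus: "Cn_up_to_boundary m J (ext_plus r l) P"
  proof -
    let ?D = "ext_plus r l"
    have mid: "(r + l) / 2 \<in> ?D"
      using rl by (simp add: ext_plus_def)
    have "Cn_up_to_boundary (Suc m) J ?D \<zeta>"
      using Cn_E(1)[of ?D] by (simp add: m)
    then have mn: "Cn_up_to_boundary m J ?D (\<lambda>t x. mean_plus r l \<zeta> t)"
      by (intro Cn_mean_plus[OF time rl(2) open_domains(3) Cn_Suc_imp])
    have "Cn_up_to_boundary m J ?D (\<lambda>t x. damping_op \<kappa> (mean_plus r l \<zeta>) t)"
      by (rule Cn_damping_op[OF time open_domains(3) mid mn])
    from Cn_lincomb[OF open_domains(3) time_nontrivial mn this, of "\<epsilon> * P0" "- \<epsilon> * P0 * \<kappa>"]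
    show ?thesis
      by (rule Cn_cong[OF open_domains(3), rotated]) (simp_all add: P_plus p_def algebra_simps)
  qed
  have decay': "decaying n J r \<zeta>'" "decaying n J r q'"
  proof -
    have dec: "decaying n J r \<zeta>" "decaying n J r q"
      using reg by (simp_all add: regular_transmission_def)
    show "decaying n J r \<zeta>'"
      by (rule decaying_cong[OF _ dec(1)]) (simp add: \<zeta>'_E exterior_dom_def ext_minus_def)
    show "decaying n J r q'"
      by (rule decaying_cong[OF _ dec(2)]) (simp add: q'_E exterior_dom_def ext_minus_def)
  qed
  have reg': "regular_constrained n r l J \<zeta>' q' P"
    unfolding regular_constrained_def
    using Cn' Cn'_I Cn_P_I Cn_P_minus Cn_P_plus decay' by (simp add: m)

  have eqs: "pd_t J \<zeta> t x + pd_x q t x = 0"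
      "pd_t J q t x - \<mu>'\<^sup>2 * pd_x (pd_x (pd_t J q)) t x
        + \<epsilon> * pd_x (\<lambda>t x. (q t x)\<^sup>2 / depth \<epsilon> \<zeta> t x) t x
        + depth \<epsilon> \<zeta> t x * pd_x \<zeta> t x = 0" if "t \<in> J" "x \<in> ?E" for t x
    using trans that unfolding transmission_problem_def by blast+
  have pos: "positive_depth \<epsilon> J D \<zeta>'" if D: "D \<in> {ext_minus r, ?I, ext_plus r l}" for D
  proof (cases "D = ?I")
    case True
    then show ?thesis
      using hw by (auto simp: positive_depth_def depth_def \<zeta>'_I)
  next
    case False
    with D have sub: "D \<subseteq> ?E"
      using subE by blast
    have "positive_depth \<epsilon> J ?E \<zeta>"
      using trans by (simp add: transmission_problem_def)
    then show ?thesis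
      unfolding positive_depth_def depth_def using sub \<zeta>'_E by (metis subsetD)
  qed
  have "pd_t J \<zeta>' t x + pd_x q' t x = 0 \<and>
           pd_t J q' t x - \<mu> / 3 * pd_x (pd_x (pd_t J q')) t x
             + \<epsilon> * pd_x (\<lambda>t x. (q' t x)\<^sup>2 / depth \<epsilon> \<zeta>' t x) t x
             + depth \<epsilon> \<zeta>' t x * pd_x \<zeta>' t x
           = - depth \<epsilon> \<zeta>' t x / \<epsilon> * pd_x P t x"
    if D: "D \<in> {ext_minus r, ?I, ext_plus r l}" and t: "t \<in> J" and x: "x \<in> D" for D t x
  proof (cases "D = ?I")
    case True
    with x have x: "x \<in> ?I"
      by simp
    have "(P t has_field_derivative - \<epsilon> / (1 + \<epsilon> * \<zeta>w) * d t) (at x)"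
    proof (rule has_field_derivative_transform_within_open[OF _ open_domains(1) x])
      show "((\<lambda>x. - \<epsilon> / (1 + \<epsilon> * \<zeta>w) * d t * x) has_field_derivative - \<epsilon> / (1 + \<epsilon> * \<zeta>w) * d t) (at x)"
        by (rule DERIV_cmult_Id)
    qed (simp add: P_I)
    from pd_x_eqI[where u = P, OF this]
    have Px: "pd_x P t x = - \<epsilon> / (1 + \<epsilon> * \<zeta>w) * d t" .
    have "1 + \<epsilon> * \<zeta>w \<noteq> 0" "\<epsilon> \<noteq> 0"
      using eps hw by auto
    \<comment> \<open>The slope of \<open>P\<close> cancels the factor in front of the gradient,
      leaving the only term that survives on the left.\<close>
    then have "- depth \<epsilon> \<zeta>' t x / \<epsilon> * pd_x P t x = d t"
      unfolding Px depth_def \<zeta>'_I[OF x] by (simp add: divide_simps, simp add: algebra_simps)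
    moreover have "pd_t J \<zeta>' t x = 0"
      by (rule constant_state_pd_t[OF \<zeta>'_I t x time_nontrivial[OF t]])
    ultimately show ?thesis
      using constant_state_derivs[of J ?I \<zeta>' \<zeta>w q' qi t x, OF \<zeta>'_I q'_I open_domains(1) t x]
      by (simp add: d_def)
  next
    case False
    with D x have xE: "x \<in> ?E"
      by (auto simp: exterior_dom_def)
    have "pd_x P t x = 0"
    proof (cases "D = ext_minus r")
      case True
      then show ?thesis
        using x P_minus by (intro pd_x_const[OF open_domains(2)[of r]]) auto
    next
      case F: False
      then show ?thesis
        using x P_plus False D by (intro pd_x_const[OF open_domains(3)[of r l]]) auto
    qed
    \<comment> \<open>Agreement is needed at every \<open>y\<close> of the open exterior, not only
      at \<open>x\<close>, because these time derivatives are differentiated in space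
      afterwards.\<close>
    moreover have qt: "pd_t J q' t y = pd_t J q t y" "pd_t J \<zeta>' t y = pd_t J \<zeta> t y" if "y \<in> ?E" for y
      using that t by (auto intro!: pd_t_cong simp: \<zeta>'_E q'_E)
    moreover note pc = pd_x_cong[OF open_domains(4)[of r l]]
    have "pd_x (pd_t J q') t y = pd_x (pd_t J q) t y" if "y \<in> ?E" for y
      by (rule pc[OF that]) (rule qt(1))
    then have "pd_x (pd_x (pd_t J q')) t x = pd_x (pd_x (pd_t J q)) t x"
      by (rule pc[OF xE]) blast
    moreover have "pd_x q' t x = pd_x q t x" "pd_x \<zeta>' t x = pd_x \<zeta> t x"
      "pd_x (\<lambda>t x. (q' t x)\<^sup>2 / depth \<epsilon> \<zeta>' t x) t x = pd_x (\<lambda>t x. (q t x)\<^sup>2 / depth \<epsilon> \<zeta> t x) t x"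
      by (rule pc[OF xE]; simp add: \<zeta>'_E q'_E depth_def)+
    ultimately show ?thesis
      using eqs[OF t xE] xE by (simp add: mu'_square depth_def \<zeta>'_E)
  qed
  moreover have "decay_bc J \<zeta>' q'"
  proof -
    have "\<forall>\<^sub>F x in at_bot. x \<in> ?E"
      by (rule eventually_mono[OF eventually_gt_at_bot[of "-r"]])
         (simp add: exterior_dom_def ext_minus_def)
    then have "(\<zeta>' t \<longlongrightarrow> L) at_bot \<longleftrightarrow> (\<zeta> t \<longlongrightarrow> L) at_bot" "(q' t \<longlongrightarrow> L) at_bot \<longleftrightarrow> (q t \<longlongrightarrow> L) at_bot" for t L
      by (auto intro!: tendsto_cong elim!: eventually_mono simp: \<zeta>'_E q'_E)
    then show ?thesis
      using trans by (simp add: transmission_problem_def decay_bc_def)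
  qed
  moreover have "wall_bc J r l q'"
  proof -
    have "trace (ext_plus r l) l (q' t) = trace (ext_plus r l) l (q t)" for t
      by (rule trace_cong) (simp add: q'_E exterior_dom_def)
    then show ?thesis
      using trans by (simp add: transmission_problem_def wall_bc_def)
  qed
  ultimately have model': "constrained_model \<epsilon> \<mu> r l P0 \<kappa> \<zeta>w J \<zeta>' q' P"
    unfolding constrained_model_def using pos \<zeta>'_I P_minus P_plus by (simp add: mean p_def)

  have cont': "discharge_continuity r l J q' qi"
  proof -
    have "trace ?E a (q' t) = trace ?E a (q t)" for a t
      by (rule trace_cong) (simp add: q'_E)
    \<comment> \<open>A zero jump makes the two traces equal, and the average identifies their
      common value.\<close>
    moreover have "trace ?E r (q t) = qi t \<and> trace ?E (-r) (q t) = qi t" if "t \<in> J" for t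
    proof -
      have "jump r ?E (q t) = 0" "average r ?E (q t) = qi t"
        using trans that by (simp_all add: transmission_problem_def)
      then show ?thesis
        by (simp add: jump_def average_def)
    qed
    ultimately show ?thesis
      by (auto simp: discharge_continuity_def)
  qed

  have "energy_coupling \<epsilon> \<mu>' r l J \<zeta>' q' P"
    unfolding energy_coupling_def
  proof
    fix t assume t: "t \<in> J"
    let ?head = "\<lambda>x. \<zeta> t x + frakE \<epsilon> \<mu>' J \<zeta> q t x" and ?head' = "\<lambda>x. \<zeta>' t x + frakE \<epsilon> \<mu>' J \<zeta>' q' t x"
    have "jump r ?I (P t) = 2 * r * (- \<epsilon> / (1 + \<epsilon> * \<zeta>w) * d t)"
      by (rule jump_interior_affine[OF rl(1) P_I])
    have "jump r ?I (P t) / \<epsilon> = - (\<alpha> * d t)"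
    proof -
      have "2 * r * (- \<epsilon> / (1 + \<epsilon> * \<zeta>w) * d t) = - (\<alpha> * d t) * \<epsilon>"
        by (simp add: alpha)
      with \<open>jump r ?I (P t) = _\<close> show ?thesis
        using eps by (metis nonzero_mult_div_cancel_right less_irrefl)
    qed
    \<comment> \<open>The evolution equation of \<open>qi\<close>, now read as a statement about the
      interior pressure jump.\<close>
    also have "\<dots> = jump r ?E ?head + p t / \<epsilon>"
      using trans t eps by (simp add: transmission_problem_def d_def p_def)
    also have "jump r ?E ?head = jump r ?E ?head'"
      using frakE_cong[OF open_domains(4)[of r l] t, of _ \<zeta>' \<zeta> q' q] \<zeta>'_E q'_E
      by (intro jump_cong) simp
    also have "\<dots> + p t / \<epsilon> = jump r ?E (\<lambda>x. ?head' x + P t x / \<epsilon>)"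
      using n t Cn' pos P_minus P_plus
      by (intro jump_head_pressure[OF rl, of n, symmetric]) auto
    finally show "jump r ?I (P t) / \<epsilon> = jump r ?E (\<lambda>x. ?head' x + P t x / \<epsilon>)" .
  qed
  then show ?thesis
    using \<zeta>'_E q'_E \<zeta>'_I q'_I reg' model' cont' by blast
qed

end

theorem proposition4p6:
  fixes \<epsilon> \<mu> \<mu>' r l P0 \<kappa> \<zeta>w \<alpha> :: real and J :: "real set" and n :: nat
  assumes eps: "0 < \<epsilon>" "\<epsilon> \<le> 1"
    and mu: "0 \<le> \<mu>"
    and geometry: "0 < r" "r < l"
    and P0: "0 < P0"
    and kappa: "0 \<le> \<kappa>"
    and hw: "0 < 1 + \<epsilon> * \<zeta>w"
    and mu': "\<mu>' = sqrt (\<mu> / 3)"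
    and alpha: "\<alpha> = 2 * r / (1 + \<epsilon> * \<zeta>w)"
    and time: "is_interval J" "0 \<in> J" "J \<subseteq> {0..}" "J \<noteq> {0}"
    and smoothness: "3 \<le> n"
  shows
    "(\<forall>\<zeta> q P. regular_constrained n r l J \<zeta> q P \<and>
        constrained_model \<epsilon> \<mu> r l P0 \<kappa> \<zeta>w J \<zeta> q P \<longrightarrow>
        (\<exists>qi. interior_discharge r J q qi) \<and>
        (\<forall>qi. interior_discharge r J q qi \<and>
           discharge_continuity r l J q qi \<and>
           energy_coupling \<epsilon> \<mu>' r l J \<zeta> q P \<longrightarrow>
           regular_transmission n r l J \<zeta> q qi \<and>
           transmission_problem \<epsilon> \<mu>' r l P0 \<kappa> \<alpha> J \<zeta> q qi)) \<and>
     (\<forall>\<zeta> q qi. regular_transmission n r l J \<zeta> q qi \<and>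
        transmission_problem \<epsilon> \<mu>' r l P0 \<kappa> \<alpha> J \<zeta> q qi \<longrightarrow>
        (\<exists>\<zeta>' q' P.
           (\<forall>t\<in>J. \<forall>x\<in>exterior_dom r l. \<zeta>' t x = \<zeta> t x \<and> q' t x = q t x) \<and>
           (\<forall>t\<in>J. \<forall>x\<in>interior_dom r. \<zeta>' t x = \<zeta>w \<and> q' t x = qi t) \<and>
           regular_constrained n r l J \<zeta>' q' P \<and>
           constrained_model \<epsilon> \<mu> r l P0 \<kappa> \<zeta>w J \<zeta>' q' P \<and>
           discharge_continuity r l J q' qi \<and>
           energy_coupling \<epsilon> \<mu>' r l J \<zeta>' q' P))"
proof (intro conjI allI impI, goal_cases)
  note hyps = eps(1) mu geometry hw mu' alpha time smoothness
  {
    case (1 \<zeta> q P)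
    then show ?case
      using constrained_imp_interior_discharge[OF hyps, of \<zeta> q P] by blast
  next
    case (2 \<zeta> q P qi)
    then show ?case
      using constrained_imp_transmission(1)[OF hyps, of \<zeta> q P] by blast
  next
    case (3 \<zeta> q P qi)
    then show ?case
      using constrained_imp_transmission(2)[OF hyps, of \<zeta> q P] by blast
  next
    case (4 \<zeta> q qi)
    then show ?case
      by (intro transmission_imp_constrained[OF hyps]) auto
  }
qed

end
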